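(* Let $n\geq 3$ be an integer, let $K$ be a field, $S=K[x_1,\ldots,x_n]$, and let $J_{n,n-1}\subset S$ be the $(n-1)$-path ideal of the cycle graph of length $n$. Then for all integers $t\geq 1$, $$\operatorname{sdepth}(S/J_{n,n-1}^t)=\operatorname{depth}(S/J_{n,n-1}^t)=\begin{cases} n-t-1, & t\leq n-2,\\ 0, & t\geq n-1.\end{cases}$$
   Context: For integers $n>m\geq 2$, the $m$-path ideal of the cycle graph of length $n$ is the monomial ideal $J_{n,m}\subset S$ generated by the $n$ monomials $x_ix_{i+1}\cdots x_{i+m-1}$, $1\leq i\leq n$, where indices are read modulo $n$ in $\{1,\ldots,n\}$. Here $m=n-1$. Depth is taken with respect to the graded maximal ideal $(x_1,\ldots,x_n)$. For a $\mathbb Z^n$-graded $S$-module $M$, a Stanley decomposition $\mathcal D$ of $M$ is a direct sum decomposition $M=\bigoplus_{i=1}^r m_iK[Z_i]$ as a $\mathbb Z^n$-graded $K$-vector space, where each $m_i\in M$ is $\mathbb Z^n$-homogeneous, $Z_i\subset\{x_1,\ldots,x_n\}$, and $m_iK[Z_i]=\{um_i: u\in K[Z_i]\}$ is a free $K[Z_i]$-submodule of $M$. Put $\operatorname{sdepth}(\mathcal D)=\min_i|Z_i|$; the Stanley depth $\operatorname{sdepth}(M)$ is the maximum of $\operatorname{sdepth}(\mathcal D)$ over all Stanley decompositions $\mathcal D$ of $M$. *)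

theory Defs
  imports "HOL-Algebra.Algebra" "HOL-Library.Poly_Mapping"
begin

section \<open>Polynomial rings\<close>

text \<open>A monomial is a finitely supported exponent function; the variable with index \<open>i :: nat\<close>
  is \<open>x\<^sub>i\<close>. The coefficient field is a type of class \<open>field\<close>.\<close>

type_synonym 'k mpoly = "(nat \<Rightarrow>\<^sub>0 nat) \<Rightarrow>\<^sub>0 'k"

definition pvar :: "nat \<Rightarrow> 'k::field mpoly" where
  "pvar i = Poly_Mapping.single (Poly_Mapping.single i 1) 1"

text \<open>\<open>mpoly_ring Z\<close> is \<open>K[x\<^sub>i : i \<in> Z]\<close>; in particular \<open>mpoly_ring {1..n}\<close> is
  \<open>S = K[x\<^sub>1,\<dots>,x\<^sub>n]\<close>, and for \<open>Z \<subseteq> {1..n}\<close> the carrier of \<open>mpoly_ring Z\<close> is the subset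
  \<open>K[Z]\<close> of \<open>S\<close>.\<close>

definition mpoly_ring :: "nat set \<Rightarrow> 'k::field mpoly ring" where
  "mpoly_ring Z = \<lparr>carrier = {p. \<forall>e \<in> Poly_Mapping.keys p. Poly_Mapping.keys e \<subseteq> Z},
                  monoid.mult = (*), monoid.one = 1, ring.zero = 0, ring.add = (+)\<rparr>"

definition graded_max_ideal :: "nat \<Rightarrow> 'k::field mpoly set" where
  "graded_max_ideal n = genideal (mpoly_ring {1..n}) (pvar ` {1..n})"

text \<open>The generators are \<open>x\<^sub>i x\<^sub>i\<^sub>+\<^sub>1 \<cdots> x\<^sub>i\<^sub>+\<^sub>m\<^sub>-\<^sub>1\<close>, \<open>i \<in> {1..n}\<close>;
  the expression \<open>(k - 1) mod n + 1\<close> is the representative of \<open>k\<close> modulo \<open>n\<close> in \<open>{1..n}\<close>.\<close>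

definition cycle_path_ideal :: "nat \<Rightarrow> nat \<Rightarrow> 'k::field mpoly set" where
  "cycle_path_ideal n m =
     genideal (mpoly_ring {1..n})
       ((\<lambda>i. \<Prod>k = i..<i + m. pvar ((k - 1) mod n + 1)) ` {1..n})"


section \<open>The module \<open>R/I\<close>\<close>

definition quot_module :: "'a ring \<Rightarrow> 'a set \<Rightarrow> ('a, 'a set) module" where
  "quot_module R I =
     \<lparr>carrier = carrier (R Quot I), monoid.mult = monoid.mult (R Quot I),
      monoid.one = monoid.one (R Quot I),
      ring.zero = ring.zero (R Quot I), ring.add = ring.add (R Quot I),
      smult = (\<lambda>r C. (I +>\<^bsub>R\<^esub> r) \<otimes>\<^bsub>R Quot I\<^esub> C)\<rparr>"


section \<open>Depth\<close>

text \<open>\<open>seq_smult M as\<close> is the submodule \<open>(a\<^sub>1,\<dots>,a\<^sub>s)M = a\<^sub>1 M + \<cdots> + a\<^sub>s M\<close>.\<close>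

definition seq_smult :: "('a, 'm) module \<Rightarrow> 'a list \<Rightarrow> 'm set" where
  "seq_smult M as =
     {\<Oplus>\<^bsub>M\<^esub>j\<in>{..<length as}. (as ! j) \<odot>\<^bsub>M\<^esub> y j | y. y \<in> {..<length as} \<rightarrow> carrier M}"

text \<open>The second conjunct says that \<open>a\<^sub>i\<^sub>+\<^sub>1\<close> is a nonzerodivisor on
  \<open>M/(a\<^sub>1,\<dots>,a\<^sub>i)M\<close>, the third that \<open>M/(a\<^sub>1,\<dots>,a\<^sub>s)M\<close> is nonzero.\<close>

definition regular_seq :: "'a ring \<Rightarrow> ('a, 'm) module \<Rightarrow> 'a list \<Rightarrow> bool" where
  "regular_seq R M as \<longleftrightarrow>
     set as \<subseteq> carrier R \<and>
     (\<forall>i < length as. \<forall>x \<in> carrier M.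
        (as ! i) \<odot>\<^bsub>M\<^esub> x \<in> seq_smult M (take i as) \<longrightarrow> x \<in> seq_smult M (take i as)) \<and>
     seq_smult M as \<noteq> carrier M"

text \<open>Meant for finitely generated \<open>M\<close> over a Noetherian ring with \<open>\<mm>M \<noteq> M\<close>, where the maximum
  exists; note that \<^const>\<open>Max\<close> of an empty or infinite set is unspecified.\<close>

definition depth :: "'a ring \<Rightarrow> 'a set \<Rightarrow> ('a, 'm) module \<Rightarrow> nat" where
  "depth R \<mm> M = Max {length as | as. set as \<subseteq> \<mm> \<and> regular_seq R M as}"


section \<open>Gradings by \<open>\<int>\<^sup>n\<close> and Stanley depth\<close>

definition multidegrees :: "nat \<Rightarrow> (nat \<Rightarrow> int) set" where
  "multidegrees n = {1..n} \<rightarrow>\<^sub>E UNIV"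

text \<open>A grading is given by its family of homogeneous components. In \<open>S\<close>, the component of degree
  \<open>a\<close> is \<open>K x\<^sup>a\<close> if all entries of \<open>a\<close> are nonnegative, and \<open>0\<close> otherwise; \<open>S/I\<close> (for a monomial
  ideal \<open>I\<close>) carries the image grading.\<close>

definition poly_component :: "nat \<Rightarrow> (nat \<Rightarrow> int) \<Rightarrow> 'k::field mpoly set" where
  "poly_component n a =
     {p \<in> carrier (mpoly_ring {1..n}).
        \<forall>e \<in> Poly_Mapping.keys p. \<forall>i \<in> {1..n}. int (Poly_Mapping.lookup e i) = a i}"

definition quot_component ::
  "nat \<Rightarrow> 'k::field mpoly set \<Rightarrow> (nat \<Rightarrow> int) \<Rightarrow> 'k mpoly set set" where
  "quot_component n I a = (\<lambda>p. I +>\<^bsub>mpoly_ring {1..n}\<^esub> p) ` poly_component n a"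

definition stanley_space :: "('k::field mpoly, 'm) module \<Rightarrow> 'm \<Rightarrow> nat set \<Rightarrow> 'm set" where
  "stanley_space M m Z = (\<lambda>u. u \<odot>\<^bsub>M\<^esub> m) ` carrier (mpoly_ring Z)"

text \<open>\<open>M = m\<^sub>1K[Z\<^sub>1] \<oplus> \<cdots> \<oplus> m\<^sub>rK[Z\<^sub>r]\<close>, where \<open>G\<close> is the grading of \<open>M\<close>. Injectivity of
  \<open>u \<mapsto> u m\<^sub>i\<close> on \<open>K[Z\<^sub>i]\<close> is freeness of \<open>m\<^sub>iK[Z\<^sub>i]\<close>. As the \<open>m\<^sub>i\<close> are
  homogeneous, the summands are graded subspaces, so the decomposition is one of graded vector
  spaces as soon as it is a direct sum.\<close>

definition stanley_decomposition ::
  "nat \<Rightarrow> ('k::field mpoly, 'm) module \<Rightarrow> ((nat \<Rightarrow> int) \<Rightarrow> 'm set) \<Rightarrow>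
   nat \<Rightarrow> (nat \<Rightarrow> 'm) \<Rightarrow> (nat \<Rightarrow> nat set) \<Rightarrow> bool" where
  "stanley_decomposition n M G r m Z \<longleftrightarrow>
     (\<forall>i \<in> {1..r}.
        m i \<in> carrier M \<and> (\<exists>a \<in> multidegrees n. m i \<in> G a) \<and> Z i \<subseteq> {1..n} \<and>
        inj_on (\<lambda>u. u \<odot>\<^bsub>M\<^esub> m i) (carrier (mpoly_ring (Z i)))) \<and>
     (\<forall>x \<in> carrier M.
        \<exists>!y. y \<in> (\<Pi>\<^sub>E i\<in>{1..r}. stanley_space M (m i) (Z i)) \<and> x = (\<Oplus>\<^bsub>M\<^esub>i\<in>{1..r}. y i))"

text \<open>Meant for \<open>M \<noteq> 0\<close>, so that every decomposition has \<open>r \<ge> 1\<close>.\<close>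

definition sdepth ::
  "nat \<Rightarrow> ('k::field mpoly, 'm) module \<Rightarrow> ((nat \<Rightarrow> int) \<Rightarrow> 'm set) \<Rightarrow> nat" where
  "sdepth n M G =
     Max {Min ((\<lambda>i. card (Z i)) ` {1..r}) | r m Z. stanley_decomposition n M G r m Z}"


section \<open>Well-formedness\<close>

lemma mpoly_ring_cring: "cring (mpoly_ring Z :: 'k::field mpoly ring)"
proof -
  have add: "p + q \<in> carrier (mpoly_ring Z)"
    if "p \<in> carrier (mpoly_ring Z)" "q \<in> carrier (mpoly_ring Z)" for p q :: "'k mpoly"
    using that Poly_Mapping.keys_add[of p q] by (auto simp: mpoly_ring_def)
  have mult: "p * q \<in> carrier (mpoly_ring Z)"
    if "p \<in> carrier (mpoly_ring Z)" "q \<in> carrier (mpoly_ring Z)" for p q :: "'k mpoly"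
  proof -
    have "Poly_Mapping.keys e \<subseteq> Z" if e: "e \<in> Poly_Mapping.keys (p * q)" for e
    proof -
      obtain a b where "e = a + b" "a \<in> Poly_Mapping.keys p" "b \<in> Poly_Mapping.keys q"
        using keys_mult[of p q] e by blast
      with \<open>p \<in> _\<close> \<open>q \<in> _\<close> show ?thesis
        using Poly_Mapping.keys_add[of a b] by (fastforce simp: mpoly_ring_def)
    qed
    then show ?thesis by (auto simp: mpoly_ring_def)
  qed
  have zero: "(0 :: 'k mpoly) \<in> carrier (mpoly_ring Z)"
    and one: "(1 :: 'k mpoly) \<in> carrier (mpoly_ring Z)"
    by (simp_all add: mpoly_ring_def)
  have uminus: "- p \<in> carrier (mpoly_ring Z)" if "p \<in> carrier (mpoly_ring Z)" for p :: "'k mpoly"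
    using that by (simp add: mpoly_ring_def)
  have ops: "p \<oplus>\<^bsub>mpoly_ring Z\<^esub> q = p + q" "p \<otimes>\<^bsub>mpoly_ring Z\<^esub> q = p * q"
      "\<zero>\<^bsub>mpoly_ring Z\<^esub> = (0 :: 'k mpoly)" "\<one>\<^bsub>mpoly_ring Z\<^esub> = (1 :: 'k mpoly)" for p q :: "'k mpoly"
    by (simp_all add: mpoly_ring_def)
  show ?thesis
  proof (rule cringI)
    show "abelian_group (mpoly_ring Z :: 'k mpoly ring)"
    proof (rule abelian_groupI)
      fix p :: "'k mpoly" assume "p \<in> carrier (mpoly_ring Z)"
      then show "\<exists>q \<in> carrier (mpoly_ring Z). q \<oplus>\<^bsub>mpoly_ring Z\<^esub> p = \<zero>\<^bsub>mpoly_ring Z\<^esub>"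
        using uminus by (intro bexI[of _ "- p"]) (simp_all add: ops)
    qed (simp_all add: ops add zero add.assoc add.commute)
    show "comm_monoid (mpoly_ring Z :: 'k mpoly ring)"
      by (rule comm_monoidI) (simp_all add: ops mult one mult.assoc mult.commute)
  qed (simp add: ops distrib_right)
qed

lemma quot_module_module:
  assumes "cring R" "ideal I R"
  shows "module R (quot_module R I)"
proof -
  interpret R: cring R by fact
  interpret I: ideal I R by fact
  interpret Q: cring "R Quot I" by (rule I.quotient_is_cring[OF R.is_cring])
  interpret h: ring_hom_ring R "R Quot I" "(+>\<^bsub>R\<^esub>) I" by (rule I.rcos_ring_hom_ring)
  have abl: "abelian_group (quot_module R I)"
    by (rule abelian_groupI)
       (simp_all add: quot_module_def Q.a_assoc Q.a_comm Q.add.l_inv_ex Q.add.m_lcomm)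
  have hc: "I +>\<^bsub>R\<^esub> r \<in> carrier (R Quot I)" if "r \<in> carrier R" for r
    using that by (rule h.hom_closed)
  show ?thesis
    by (rule moduleI[OF R.is_cring abl])
       (simp_all add: quot_module_def hc Q.l_distr Q.r_distr Q.m_assoc h.hom_add h.hom_mult h.hom_one)
qed

end

theory Submission
  imports Defs
begin

text \<open>A monomial \<open>x\<^sup>e\<close> lies in \<open>J\<^sup>t\<close> iff its total deficit \<open>\<Sum>\<^sub>i max(0, t - e\<^sub>i)\<close> is at most \<open>t\<close>; put
  \<open>r = max(0, n - 1 - t)\<close>.

  Depth at least \<open>r\<close>: the elementary symmetric polynomials \<open>e\<^sub>1, \<dots>, e\<^sub>r\<close> form a regular sequence on
  every \<open>K[Z]\<close> with \<open>|Z| \<ge> r\<close>, over any field. Replacing \<open>I\<close> by \<open>I : x\<^sub>i\<close> and \<open>I + (x\<^sub>i)\<close> repeatedly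
  reduces \<open>S/J\<^sup>t\<close> to such rings: a variable that is set to \<open>0\<close> contributes at least \<open>1\<close> to the
  deficit, so at most \<open>t + 1\<close> variables are ever set to \<open>0\<close>.

  Depth at most \<open>r\<close>: the Koszul cohomology \<open>H\<^sup>r(x\<^sub>1,\<dots>,x\<^sub>n; S/J\<^sup>t)\<close> has an explicit nonzero class, and
  dividing by a nonzerodivisor of the maximal ideal lowers the degree of such a class by one.

  Stanley depth: the same counting of deficits, from left to right, gives a decomposition with
  \<open>|Z\<^sub>i| \<ge> r\<close>; conversely a monomial outside \<open>J\<^sup>t\<close> that is moved into \<open>J\<^sup>t\<close> by \<open>n - r\<close> of the variables
  lies in some \<open>m\<^sub>i K[Z\<^sub>i]\<close>, and \<open>Z\<^sub>i\<close> contains none of these variables.\<close>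

section \<open>Regular sequences modulo an ideal\<close>

text \<open>The condition on deficits comes from the generators: each omits exactly one variable, so
  a product of \<open>t\<close> of them has exponents \<open>t - a_i\<close>, where
  \<open>a_i\<close> counts the omissions of \<open>x_i\<close> and the \<open>a_i\<close> add up to
  \<open>t\<close>. Branching over the variables needs one and the same sequence to be regular at
  every leaf, while the leaves kill different sets of variables. General linear forms would serve,
  but a finite field may have too few of them; elementary symmetric polynomials restrict to those in
  the remaining variables, whichever ones are killed. For the upper bound on depth, the regular
  sequence is arbitrary and need not be homogeneous, so degree arguments do not apply to it;
  nonvanishing of Koszul cohomology is a property of the ideal alone and survives each division.
  Both upper bounds use the same monomial \<open>x^e\<close>: times at most \<open>r\<close>
  distinct variables it stays outside the ideal, times \<open>r + 1\<close> distinct ones it is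
  inside.\<close>

definition adjoin :: "'a::comm_ring_1 set \<Rightarrow> 'a set \<Rightarrow> 'a \<Rightarrow> 'a set" where
  "adjoin C I a = {p + a * y | p y. p \<in> I \<and> y \<in> C}"

definition ideal_in :: "'a::comm_ring_1 set \<Rightarrow> 'a set \<Rightarrow> bool" where
  "ideal_in C I \<longleftrightarrow>
     I \<subseteq> C \<and> 0 \<in> I \<and> (\<forall>a\<in>I. \<forall>b\<in>I. a + b \<in> I) \<and> (\<forall>a\<in>I. \<forall>c\<in>C. c * a \<in> I)"

definition nzd_mod :: "'a::comm_ring_1 set \<Rightarrow> 'a set \<Rightarrow> 'a \<Rightarrow> bool" where
  "nzd_mod C I a \<longleftrightarrow> (\<forall>f\<in>C. a * f \<in> I \<longrightarrow> f \<in> I)"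

text \<open>Properness of the final ideal is left out on purpose: colon ideals in the later
  induction can become the whole ring, where every sequence qualifies.\<close>

primrec weakly_regular :: "'a::comm_ring_1 set \<Rightarrow> 'a set \<Rightarrow> 'a list \<Rightarrow> bool" where
  "weakly_regular C I [] \<longleftrightarrow> True"
| "weakly_regular C I (a # as) \<longleftrightarrow> nzd_mod C I a \<and> weakly_regular C (adjoin C I a) as"

lemma weakly_regular_append:
  "weakly_regular C I (as @ bs) \<longleftrightarrow>
     weakly_regular C I as \<and> weakly_regular C (foldl (adjoin C) I as) bs"
  by (induction as arbitrary: I) auto

lemma weakly_regular_iff_nth:
  "weakly_regular C I as \<longleftrightarrow>
     (\<forall>i<length as. nzd_mod C (foldl (adjoin C) I (take i as)) (as ! i))"
proof (induction as rule: rev_induct)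
  case (snoc a as)
  have "(\<forall>i<length (as @ [a]). nzd_mod C (foldl (adjoin C) I (take i (as @ [a]))) ((as @ [a]) ! i)) \<longleftrightarrow>
        (\<forall>i<length as. nzd_mod C (foldl (adjoin C) I (take i as)) (as ! i)) \<and>
        nzd_mod C (foldl (adjoin C) I as) a"
    by (auto simp: less_Suc_eq nth_append all_conj_distrib)
  with snoc show ?case by (simp add: weakly_regular_append)
qed auto

lemma adjoinE:
  assumes "p \<in> adjoin C I a"
  obtains q y where "q \<in> I" "y \<in> C" "p = q + a * y"
  using assms by (auto simp: adjoin_def)

lemma adjoinI: "q \<in> I \<Longrightarrow> y \<in> C \<Longrightarrow> q + a * y \<in> adjoin C I a"
  by (auto simp: adjoin_def)

text \<open>Rings are subsets of a type of class \<open>comm_ring_1\<close>, so that type-class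
  arithmetic and \<open>sum\<close> apply to them; the instances used below are the carriers
  \<open>polys Z\<close>.\<close>

locale subring_of_type =
  fixes C :: "'a::comm_ring_1 set"
  assumes one_closed [simp, intro]: "1 \<in> C"
    and diff_closed [simp, intro]: "a \<in> C \<Longrightarrow> b \<in> C \<Longrightarrow> a - b \<in> C"
    and mult_closed [simp, intro]: "a \<in> C \<Longrightarrow> b \<in> C \<Longrightarrow> a * b \<in> C"
begin

lemma zero_closed [simp, intro]: "0 \<in> C"
  using diff_closed[of 1 1] by simp

lemma uminus_closed [simp, intro]: "a \<in> C \<Longrightarrow> - a \<in> C"
  using diff_closed[of 0 a] by simp

lemma add_closed [simp, intro]: "a \<in> C \<Longrightarrow> b \<in> C \<Longrightarrow> a + b \<in> C"
  using diff_closed[of a "- b"] by simp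

lemma sum_closed [intro]: "(\<And>i. i \<in> A \<Longrightarrow> f i \<in> C) \<Longrightarrow> sum f A \<in> C"
  by (induction A rule: infinite_finite_induct) auto

lemma prod_closed [intro]: "(\<And>i. i \<in> A \<Longrightarrow> f i \<in> C) \<Longrightarrow> prod f A \<in> C"
  by (induction A rule: infinite_finite_induct) auto

lemma power_closed [simp, intro]: "a \<in> C \<Longrightarrow> a ^ k \<in> C"
  by (induction k) auto

context
  fixes I assumes I: "ideal_in C I"
begin

lemma ideal_subset: "I \<subseteq> C" and ideal_zero: "0 \<in> I"
  and ideal_add: "a \<in> I \<Longrightarrow> b \<in> I \<Longrightarrow> a + b \<in> I"
  and ideal_mult: "a \<in> I \<Longrightarrow> c \<in> C \<Longrightarrow> c * a \<in> I"
  using I by (auto simp: ideal_in_def)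

lemma ideal_mult': "a \<in> I \<Longrightarrow> c \<in> C \<Longrightarrow> a * c \<in> I"
  using ideal_mult[of a c] by (simp add: mult.commute)

lemma ideal_uminus: "a \<in> I \<Longrightarrow> - a \<in> I"
  using ideal_mult[of a "- 1"] by auto

lemma ideal_diff: "a \<in> I \<Longrightarrow> b \<in> I \<Longrightarrow> a - b \<in> I"
  using ideal_add[of a "- b"] ideal_uminus[of b] by auto

lemma ideal_sum: "(\<And>i. i \<in> A \<Longrightarrow> f i \<in> I) \<Longrightarrow> sum f A \<in> I"
  by (induction A rule: infinite_finite_induct) (auto intro: ideal_zero ideal_add)

lemma ideal_cong: "a - b \<in> I \<Longrightarrow> a \<in> I \<longleftrightarrow> b \<in> I"
  using ideal_add[of "a - b" b] ideal_diff[of a "a - b"] by auto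

lemma ideal_in_adjoin: assumes "a \<in> C" shows "ideal_in C (adjoin C I a)"
  unfolding ideal_in_def
proof (intro conjI ballI subsetI)
  fix p assume "p \<in> adjoin C I a"
  then show "p \<in> C" using assms ideal_subset by (auto elim!: adjoinE)
next
  show "0 \<in> adjoin C I a" using adjoinI[OF ideal_zero zero_closed, of a] by simp
next
  fix p q assume "p \<in> adjoin C I a" "q \<in> adjoin C I a"
  then obtain p' q' y z where *: "p' \<in> I" "q' \<in> I" "y \<in> C" "z \<in> C"
    "p = p' + a * y" "q = q' + a * z" by (auto elim!: adjoinE)
  have "(p' + q') + a * (y + z) \<in> adjoin C I a"
    using *(1-4) by (intro adjoinI ideal_add add_closed)
  then show "p + q \<in> adjoin C I a" by (simp add: *(5,6) algebra_simps)
next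
  fix p c assume "p \<in> adjoin C I a" and c: "c \<in> C"
  then obtain p' y where *: "p' \<in> I" "y \<in> C" "p = p' + a * y" by (auto elim!: adjoinE)
  have "c * p' + a * (c * y) \<in> adjoin C I a"
    using *(1,2) c by (intro adjoinI ideal_mult mult_closed)
  then show "c * p \<in> adjoin C I a" by (simp add: *(3) algebra_simps)
qed

lemma subset_adjoin: "I \<subseteq> adjoin C I a"
  using adjoinI[OF _ zero_closed, of _ I a] by auto

lemma mult_in_adjoin: "y \<in> C \<Longrightarrow> a * y \<in> adjoin C I a"
  using adjoinI[OF ideal_zero, of y C a] by simp

end

lemma ideal_in_foldl_adjoin:
  "ideal_in C I \<Longrightarrow> set as \<subseteq> C \<Longrightarrow> ideal_in C (foldl (adjoin C) I as)"
  by (induction as arbitrary: I) (auto intro: ideal_in_adjoin)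

lemma adjoin_commute: "adjoin C (adjoin C I a) b = adjoin C (adjoin C I b) a"
proof -
  have "adjoin C (adjoin C I a) b \<subseteq> adjoin C (adjoin C I b) a" for a b
  proof
    fix p assume "p \<in> adjoin C (adjoin C I a) b"
    then obtain q y z where *: "q \<in> I" "y \<in> C" "z \<in> C" "p = (q + a * y) + b * z"
      by (auto elim!: adjoinE)
    have "(q + b * z) + a * y \<in> adjoin C (adjoin C I b) a"
      using *(1-3) by (intro adjoinI)
    then show "p \<in> adjoin C (adjoin C I b) a" by (simp add: *(4) algebra_simps)
  qed
  then show ?thesis by blast
qed

text \<open>The closed form matches the combinations that make up \<open>seq_smult\<close>.\<close>

lemma foldl_adjoin_eq:
  assumes "ideal_in C I"
  shows "foldl (adjoin C) I as =
     {p + (\<Sum>j<length as. as ! j * y j) | p y. p \<in> I \<and> (\<forall>j<length as. y j \<in> C)}"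
proof (induction as rule: rev_induct)
  case Nil
  show ?case by auto
next
  case (snoc a as)
  have eq: "(\<Sum>j<length as. (as @ [a]) ! j * y j) = (\<Sum>j<length as. as ! j * y j)" for y
    by (rule sum.cong) (auto simp: nth_append)
  show ?case
  proof (intro equalityI subsetI)
    fix f assume "f \<in> foldl (adjoin C) I (as @ [a])"
    then obtain p y z where *: "p \<in> I" "\<forall>j<length as. y j \<in> C" "z \<in> C"
      "f = p + (\<Sum>j<length as. as ! j * y j) + a * z"
      by (auto simp: snoc adjoin_def)
    let ?y = "y(length as := z)"
    have "f = p + (\<Sum>j<length (as @ [a]). (as @ [a]) ! j * ?y j)"
      using * by (simp add: eq nth_append add.assoc)
    with * show "f \<in> {p + (\<Sum>j<length (as @ [a]). (as @ [a]) ! j * y j) | p y.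
        p \<in> I \<and> (\<forall>j<length (as @ [a]). y j \<in> C)}"
      by (auto intro!: exI[of _ p] exI[of _ ?y])
  next
    fix f assume "f \<in> {p + (\<Sum>j<length (as @ [a]). (as @ [a]) ! j * y j) | p y.
        p \<in> I \<and> (\<forall>j<length (as @ [a]). y j \<in> C)}"
    then obtain p y where *: "p \<in> I" "\<forall>j<Suc (length as). y j \<in> C"
      "f = p + (\<Sum>j<length (as @ [a]). (as @ [a]) ! j * y j)"
      by auto
    then have "f = (p + (\<Sum>j<length as. as ! j * y j)) + a * y (length as)"
      by (simp add: eq nth_append add.assoc)
    moreover have "p + (\<Sum>j<length as. as ! j * y j) \<in> foldl (adjoin C) I as"
      unfolding snoc using *(1,2) less_SucI by blast
    ultimately show "f \<in> foldl (adjoin C) I (as @ [a])"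
      using *(2) by (simp add: adjoinI)
  qed
qed

text \<open>In the next three lemmas only the first step of a regular sequence needs an argument, because
  \<open>adjoin\<close> commutes with the operations on ideals involved. The first one comes from the exact
  sequence \<open>0 \<rightarrow> S/(I : x) \<rightarrow> S/I \<rightarrow> S/(I + xS) \<rightarrow> 0\<close>.\<close>

lemma weakly_regular_colon:
  assumes "ideal_in C I" "x \<in> C" "set as \<subseteq> C"
    and "weakly_regular C {g \<in> C. x * g \<in> I} as" "weakly_regular C (adjoin C I x) as"
  shows "weakly_regular C I as"
  using assms
proof (induction as arbitrary: I)
  case (Cons a as)
  note I = Cons.prems(1) and x = Cons.prems(2)
  have a: "a \<in> C" and as: "set as \<subseteq> C" using Cons.prems by auto
  have nzd_colon: "g \<in> C \<Longrightarrow> x * (a * g) \<in> I \<Longrightarrow> x * g \<in> I" for g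
    using Cons.prems(4) a by (auto simp: nzd_mod_def)
  have nzd_sum: "f \<in> C \<Longrightarrow> a * f \<in> adjoin C I x \<Longrightarrow> f \<in> adjoin C I x" for f
    using Cons.prems(5) by (auto simp: nzd_mod_def)
  have nzd: "nzd_mod C I a"
    unfolding nzd_mod_def
  proof (intro ballI impI)
    fix f assume f: "f \<in> C" "a * f \<in> I"
    then have "f \<in> adjoin C I x" using nzd_sum subset_adjoin[OF I] by blast
    then obtain p g where pg: "p \<in> I" "g \<in> C" "f = p + x * g" by (rule adjoinE)
    have "x * (a * g) = a * f - a * p" using pg by (simp add: algebra_simps)
    then have "x * (a * g) \<in> I" using f pg a ideal_mult[OF I] by (auto intro: ideal_diff[OF I])
    then have "x * g \<in> I" using nzd_colon pg by blast
    with pg show "f \<in> I" using ideal_add[OF I] by blast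
  qed
  \<comment> \<open>Taking the colon by \<open>x\<close> commutes with adjoining \<open>a\<close>:
    as \<open>a\<close> is a nonzerodivisor modulo \<open>I + xC\<close>, the coefficient
    \<open>y\<close> of \<open>a\<close> is forced into that ideal.\<close>
  have eq: "{g \<in> C. x * g \<in> adjoin C I a} = adjoin C {g \<in> C. x * g \<in> I} a"
  proof (intro equalityI subsetI)
    fix g assume g: "g \<in> {g \<in> C. x * g \<in> adjoin C I a}"
    then obtain p y where py: "p \<in> I" "y \<in> C" "x * g = p + a * y" by (auto elim: adjoinE)
    have "- p + x * g \<in> adjoin C I x"
      using py(1) g ideal_uminus[OF I] by (intro adjoinI) auto
    then have "a * y \<in> adjoin C I x" using py(3) by simp
    then have "y \<in> adjoin C I x" using nzd_sum py by blast
    then obtain q z where qz: "q \<in> I" "z \<in> C" "y = q + x * z" by (rule adjoinE)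
    have "x * (g - a * z) = p + a * q" using py qz by (simp add: algebra_simps)
    then have "x * (g - a * z) \<in> I"
      using py qz a ideal_mult[OF I] by (auto intro: ideal_add[OF I])
    then have "(g - a * z) + a * z \<in> adjoin C {g \<in> C. x * g \<in> I} a"
      using g a qz by (intro adjoinI) auto
    then show "g \<in> adjoin C {g \<in> C. x * g \<in> I} a" by simp
  next
    fix g assume "g \<in> adjoin C {g \<in> C. x * g \<in> I} a"
    then obtain h y where "h \<in> C" "x * h \<in> I" "y \<in> C" "g = h + a * y" by (auto elim: adjoinE)
    moreover from this have "x * h + a * (x * y) \<in> adjoin C I a"
      using x by (intro adjoinI mult_closed)
    ultimately show "g \<in> {g \<in> C. x * g \<in> adjoin C I a}" using a by (simp add: algebra_simps)
  qed
  have "weakly_regular C (adjoin C I a) as"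
  proof (rule Cons.IH[OF ideal_in_adjoin[OF I a] x as])
    show "weakly_regular C {g \<in> C. x * g \<in> adjoin C I a} as"
      unfolding eq using Cons.prems(4) by simp
    show "weakly_regular C (adjoin C (adjoin C I a) x) as"
      unfolding adjoin_commute[of I a] using Cons.prems(5) by simp
  qed
  with nzd show ?case by simp
qed auto

lemma nzd_mod_adjoin:
  assumes "ideal_in C I" "x \<in> C" "a \<in> C" "nzd_mod C I x" "nzd_mod C (adjoin C I x) a"
  shows "nzd_mod C (adjoin C I a) x"
  unfolding nzd_mod_def
proof (intro ballI impI)
  fix g assume g: "g \<in> C" "x * g \<in> adjoin C I a"
  then obtain p y where py: "p \<in> I" "y \<in> C" "x * g = p + a * y" by (auto elim: adjoinE)
  have "- p + x * g \<in> adjoin C I x"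
    using py(1) g ideal_uminus[OF assms(1)] by (intro adjoinI) auto
  then have "a * y \<in> adjoin C I x" using py(3) by simp
  then have "y \<in> adjoin C I x" using assms py by (auto simp: nzd_mod_def)
  then obtain q z where qz: "q \<in> I" "z \<in> C" "y = q + x * z" by (rule adjoinE)
  \<comment> \<open>Moving the part \<open>a * x * z\<close> of the right side to the left leaves a
    multiple of \<open>x\<close> in \<open>I\<close>, from which \<open>x\<close> can be
    cancelled.\<close>
  have "x * (g - a * z) = p + a * q" using py qz by (simp add: algebra_simps)
  then have "x * (g - a * z) \<in> I"
    using py qz assms ideal_mult[OF assms(1)] by (auto intro: ideal_add[OF assms(1)])
  then have "g - a * z \<in> I" using assms g qz by (auto simp: nzd_mod_def)
  from adjoinI[OF this qz(2), of a] show "g \<in> adjoin C I a" by simp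
qed

lemma nzd_mod_foldl_adjoin:
  assumes "ideal_in C I" "x \<in> C" "set as \<subseteq> C" "nzd_mod C I x" "weakly_regular C (adjoin C I x) as"
  shows "nzd_mod C (foldl (adjoin C) I as) x"
  using assms
proof (induction as arbitrary: I)
  case (Cons a as)
  have "nzd_mod C (adjoin C I a) x"
    using Cons.prems by - (rule nzd_mod_adjoin; simp)
  moreover have "weakly_regular C (adjoin C (adjoin C I a) x) as"
    unfolding adjoin_commute[of I a] using Cons.prems(5) by simp
  ultimately show ?case
    using Cons.prems by (simp add: Cons.IH ideal_in_adjoin)
qed auto

lemma nzd_mod_prod:
  assumes "\<And>i. i \<in> A \<Longrightarrow> nzd_mod C I (f i)" "\<And>i. i \<in> A \<Longrightarrow> f i \<in> C"
  shows "nzd_mod C I (prod f A)"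
  using assms
proof (induction A rule: infinite_finite_induct)
  case (insert a A)
  then have "prod f A \<in> C" by auto
  with insert show ?case by (auto simp: nzd_mod_def mult.assoc)
qed (auto simp: nzd_mod_def)

end

section \<open>Monomial ideals\<close>

abbreviation polys :: "nat set \<Rightarrow> 'k::field mpoly set" where
  "polys Z \<equiv> carrier (mpoly_ring Z)"

abbreviation monom :: "(nat \<Rightarrow>\<^sub>0 nat) \<Rightarrow> 'k::field mpoly" where
  "monom e \<equiv> Poly_Mapping.single e 1"

lemma in_polys_iff: "p \<in> polys Z \<longleftrightarrow> (\<forall>e\<in>Poly_Mapping.keys p. Poly_Mapping.keys e \<subseteq> Z)"
  by (simp add: mpoly_ring_def)

lemma mpoly_ring_simps [simp]:
  "p \<oplus>\<^bsub>mpoly_ring Z\<^esub> q = p + q" "p \<otimes>\<^bsub>mpoly_ring Z\<^esub> q = p * q"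
  "\<zero>\<^bsub>mpoly_ring Z\<^esub> = 0" "\<one>\<^bsub>mpoly_ring Z\<^esub> = 1"
  by (simp_all add: mpoly_ring_def)

lemma keys_exp_add:
  "Poly_Mapping.keys (a + b) = Poly_Mapping.keys a \<union> Poly_Mapping.keys b"
  for a b :: "nat \<Rightarrow>\<^sub>0 nat"
  by (auto simp: in_keys_iff lookup_add)

lemma mpoly_ring_uminus: assumes "p \<in> polys Z" shows "\<ominus>\<^bsub>mpoly_ring Z\<^esub> p = - p"
proof -
  interpret cring "mpoly_ring Z" by (rule mpoly_ring_cring)
  have "- p \<in> polys Z" using assms by (simp add: in_polys_iff)
  then show ?thesis using minus_equality[of "- p" p] assms by simp
qed

lemma mpoly_ring_minus:
  assumes "p \<in> polys Z" "q \<in> polys Z" shows "p \<ominus>\<^bsub>mpoly_ring Z\<^esub> q = p - q"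
  using assms by (simp add: a_minus_def mpoly_ring_uminus)

interpretation polys: subring_of_type "polys Z" for Z
proof -
  interpret cring "mpoly_ring Z :: 'a mpoly ring" by (rule mpoly_ring_cring)
  show "subring_of_type (polys Z :: 'a mpoly set)"
  proof
    show "(1 :: 'a mpoly) \<in> polys Z" using one_closed by simp
  next
    fix a b :: "'a mpoly" assume "a \<in> polys Z" "b \<in> polys Z"
    then show "a - b \<in> polys Z" "a * b \<in> polys Z"
      using minus_closed[of a b] m_closed[of a b] by (simp_all add: mpoly_ring_minus)
  qed
qed

lemma polys_mono: "Z \<subseteq> Z' \<Longrightarrow> p \<in> polys Z \<Longrightarrow> p \<in> polys Z'"
  by (auto simp: in_polys_iff)

lemma single_in_polys: "Poly_Mapping.keys e \<subseteq> Z \<Longrightarrow> Poly_Mapping.single e c \<in> polys Z"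
  by (auto simp: in_polys_iff)

lemma pvar_in_polys [simp]: "i \<in> Z \<Longrightarrow> pvar i \<in> polys Z"
  by (auto simp: pvar_def in_polys_iff)

lemma ideal_mpoly_ring_iff:
  fixes I :: "'k::field mpoly set"
  shows "ideal I (mpoly_ring Z) \<longleftrightarrow> ideal_in (polys Z) I"
proof
  assume "ideal I (mpoly_ring Z)"
  then interpret ideal I "mpoly_ring Z" .
  show "ideal_in (polys Z) I"
    using a_subset additive_subgroup.zero_closed[OF is_additive_subgroup]
      additive_subgroup.a_closed[OF is_additive_subgroup] I_l_closed
    by (auto simp: ideal_in_def)
next
  assume I: "ideal_in (polys Z) I"
  interpret cring "mpoly_ring Z :: 'k mpoly ring" by (rule mpoly_ring_cring)
  show "ideal I (mpoly_ring Z)"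
  proof (rule idealI)
    show "ring (mpoly_ring Z :: 'k mpoly ring)" by (rule ring_axioms)
    have "a \<in> I \<Longrightarrow> \<ominus>\<^bsub>mpoly_ring Z\<^esub> a \<in> I" for a
      using polys.ideal_uminus[OF I] polys.ideal_subset[OF I] by (auto simp: mpoly_ring_uminus)
    then show "subgroup I (add_monoid (mpoly_ring Z))"
      using polys.ideal_subset[OF I] polys.ideal_zero[OF I] polys.ideal_add[OF I]
      by (intro subgroup.intro) (auto simp: a_inv_def)
  next
    fix a x :: "'k mpoly" assume "a \<in> I" "x \<in> polys Z"
    then show "x \<otimes>\<^bsub>mpoly_ring Z\<^esub> a \<in> I" "a \<otimes>\<^bsub>mpoly_ring Z\<^esub> x \<in> I"
      using polys.ideal_mult[OF I] polys.ideal_mult'[OF I] by simp_all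
  qed
qed

lemma poly_eq_sum_single:
  "p = (\<Sum>e\<in>Poly_Mapping.keys p. Poly_Mapping.single e (Poly_Mapping.lookup p e))"
  by (rule poly_mapping_eqI)
     (simp add: lookup_sum lookup_single when_def in_keys_iff sum.delta)

lemma sum_single_in_ideal:
  assumes I: "ideal_in (polys Z) I" and p: "p \<in> polys Z"
    and "\<And>e. e \<in> Poly_Mapping.keys p \<Longrightarrow> monom e \<in> I"
  shows "p \<in> I"
proof -
  have "Poly_Mapping.single e (Poly_Mapping.lookup p e) \<in> I" if "e \<in> Poly_Mapping.keys p" for e
  proof -
    have "Poly_Mapping.single 0 (Poly_Mapping.lookup p e) * monom e \<in> I"
      by (rule polys.ideal_mult[OF I]) (use assms that in \<open>auto intro: single_in_polys\<close>)
    then show ?thesis by (simp add: mult_single)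
  qed
  then show ?thesis by (subst poly_eq_sum_single) (rule polys.ideal_sum[OF I])
qed

text \<open>The \<open>K\<close>-linear projection onto the span of the monomials in
  \<open>A\<close>; it serves both for homogeneous components and for the cells of a Stanley
  decomposition.\<close>

definition restrict_keys :: "(nat \<Rightarrow>\<^sub>0 nat) set \<Rightarrow> 'k::field mpoly \<Rightarrow> 'k mpoly" where
  "restrict_keys A p = Poly_Mapping.mapp (\<lambda>e c. c when e \<in> A) p"

lemma lookup_restrict: "Poly_Mapping.lookup (restrict_keys A p) e = (Poly_Mapping.lookup p e when e \<in> A)"
  by (auto simp: restrict_keys_def lookup_mapp when_def in_keys_iff)

lemma keys_restrict: "Poly_Mapping.keys (restrict_keys A p) = Poly_Mapping.keys p \<inter> A"
  by (auto simp: in_keys_iff lookup_restrict when_def split: if_splits)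

lemma restrict_add: "restrict_keys A (p + q) = restrict_keys A p + restrict_keys A q"
  by (rule poly_mapping_eqI) (simp add: lookup_restrict lookup_add when_def)

lemma restrict_eq_self: "Poly_Mapping.keys p \<subseteq> A \<Longrightarrow> restrict_keys A p = p"
  by (rule poly_mapping_eqI) (auto simp: lookup_restrict when_def in_keys_iff)

lemma restrict_eq_0: "Poly_Mapping.keys p \<inter> A = {} \<Longrightarrow> restrict_keys A p = 0"
  by (metis keys_eq_empty keys_restrict)

lemma restrict_in_polys: "p \<in> polys Z \<Longrightarrow> restrict_keys A p \<in> polys Z"
  by (auto simp: in_polys_iff keys_restrict)

lemma restrict_compl: "restrict_keys A p + restrict_keys (- A) p = p"
  by (rule poly_mapping_eqI) (auto simp: lookup_restrict lookup_add when_def)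

lemma lookup_single_mult:
  "Poly_Mapping.lookup (Poly_Mapping.single a c * p) (a + e) = c * Poly_Mapping.lookup p e"
  for p :: "'k::field mpoly"
proof -
  have "Poly_Mapping.single a c * p = (\<Sum>f\<in>Poly_Mapping.keys p.
      Poly_Mapping.single (a + f) (c * Poly_Mapping.lookup p f))"
    by (subst poly_eq_sum_single[of p]) (simp add: sum_distrib_left mult_single)
  then show ?thesis
    by (simp add: lookup_sum lookup_single when_def in_keys_iff sum.delta)
qed

lemma keys_single_mult:
  fixes p :: "'k::field mpoly"
  assumes "c \<noteq> 0"
  shows "Poly_Mapping.keys (Poly_Mapping.single a c * p) = (+) a ` Poly_Mapping.keys p"
proof (intro equalityI subsetI)
  fix e assume e: "e \<in> Poly_Mapping.keys (Poly_Mapping.single a c * p)"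
  with keys_mult[of "Poly_Mapping.single a c" p] obtain f where "e = a + f"
    using assms by auto
  with e assms show "e \<in> (+) a ` Poly_Mapping.keys p"
    by (auto simp: in_keys_iff lookup_single_mult)
qed (use assms in \<open>auto simp: in_keys_iff lookup_single_mult\<close>)

lemma keys_pvar_mult:
  "Poly_Mapping.keys (pvar i * p) = (+) (Poly_Mapping.single i 1) ` Poly_Mapping.keys p"
  for p :: "'k::field mpoly"
  unfolding pvar_def by (simp add: keys_single_mult)

text \<open>Describing an ideal by its set of exponents turns colon ideals, sums with a variable and
  membership into operations on \<open>U\<close>.\<close>

definition monomial_ideal :: "nat set \<Rightarrow> (nat \<Rightarrow>\<^sub>0 nat) set \<Rightarrow> 'k::field mpoly set" where
  "monomial_ideal Z U = {p \<in> polys Z. Poly_Mapping.keys p \<subseteq> U}"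

definition upward_closed :: "nat set \<Rightarrow> (nat \<Rightarrow>\<^sub>0 nat) set \<Rightarrow> bool" where
  "upward_closed Z U \<longleftrightarrow> (\<forall>e\<in>U. \<forall>f. Poly_Mapping.keys f \<subseteq> Z \<longrightarrow> e + f \<in> U)"

lemma ideal_in_monomial_ideal:
  assumes "upward_closed Z U" shows "ideal_in (polys Z) (monomial_ideal Z U)"
proof -
  have "Poly_Mapping.keys (c * a) \<subseteq> U" if "Poly_Mapping.keys a \<subseteq> U" "c \<in> polys Z" for a c :: "'a mpoly"
  proof
    fix e assume "e \<in> Poly_Mapping.keys (c * a)"
    with keys_mult[of c a] obtain f g where
      "e = g + f" "f \<in> Poly_Mapping.keys c" "g \<in> Poly_Mapping.keys a" by (auto simp: add.commute)
    with assms that show "e \<in> U" by (auto simp: upward_closed_def in_polys_iff)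
  qed
  moreover have "Poly_Mapping.keys (a + b) \<subseteq> U"
    if "Poly_Mapping.keys a \<subseteq> U" "Poly_Mapping.keys b \<subseteq> U" for a b :: "'a mpoly"
    using Poly_Mapping.keys_add[of a b] that by blast
  ultimately show ?thesis by (auto simp: ideal_in_def monomial_ideal_def)
qed

lemma monom_in_monomial_ideal_iff:
  "Poly_Mapping.keys e \<subseteq> Z \<Longrightarrow> monom e \<in> monomial_ideal Z U \<longleftrightarrow> e \<in> U"
  by (auto simp: monomial_ideal_def in_polys_iff)

lemma monomial_ideal_colon:
  assumes "i \<in> Z"
  shows "{g \<in> polys Z. pvar i * g \<in> monomial_ideal Z U} =
    monomial_ideal Z {e. Poly_Mapping.single i 1 + e \<in> U}"
  using assms by (auto simp: monomial_ideal_def keys_pvar_mult)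

lemma exp_split_var:
  assumes "Poly_Mapping.lookup e i > 0"
  shows "Poly_Mapping.single i 1 + (e - Poly_Mapping.single i 1) = (e :: nat \<Rightarrow>\<^sub>0 nat)"
  by (rule poly_mapping_eqI)
     (use assms in \<open>auto simp: lookup_add lookup_minus lookup_single when_def\<close>)

lemma keys_diff_exp: "Poly_Mapping.keys (e - f :: nat \<Rightarrow>\<^sub>0 nat) \<subseteq> Poly_Mapping.keys e"
  by (auto simp: in_keys_iff lookup_minus)

lemma adjoin_pvar_monomial_ideal:
  assumes "i \<in> Z" "upward_closed Z U"
  shows "adjoin (polys Z) (monomial_ideal Z U) (pvar i) =
    monomial_ideal Z (U \<union> {e. Poly_Mapping.lookup e i > 0})" (is "?A = monomial_ideal Z ?V")
proof (intro equalityI subsetI)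
  have V: "upward_closed Z ?V"
    using assms by (auto simp: upward_closed_def lookup_add)
  note id = ideal_in_monomial_ideal[OF V]
  fix p assume "p \<in> ?A"
  then obtain q y where *: "q \<in> monomial_ideal Z U" "y \<in> polys Z" "p = q + pvar i * y"
    by (rule adjoinE)
  have "pvar i \<in> monomial_ideal Z ?V"
    using assms by (auto simp: pvar_def monomial_ideal_def in_polys_iff)
  moreover have "q \<in> monomial_ideal Z ?V" using * by (auto simp: monomial_ideal_def)
  ultimately show "p \<in> monomial_ideal Z ?V"
    using * polys.ideal_add[OF id] polys.ideal_mult'[OF id] by metis
next
  fix p :: "'a mpoly" assume p: "p \<in> monomial_ideal Z ?V"
  note id = ideal_in_monomial_ideal[OF assms(2)]
  show "p \<in> ?A"
  proof (rule sum_single_in_ideal)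
    show "ideal_in (polys Z) ?A" using id assms by (intro polys.ideal_in_adjoin) auto
    show "p \<in> polys Z" using p by (simp add: monomial_ideal_def)
    fix e assume e: "e \<in> Poly_Mapping.keys p"
    with p have eZ: "Poly_Mapping.keys e \<subseteq> Z" and eV: "e \<in> ?V"
      by (auto simp: monomial_ideal_def in_polys_iff)
    show "monom e \<in> ?A"
    proof (cases "e \<in> U")
      case True
      then have "monom e \<in> monomial_ideal Z U" using eZ by (simp add: monom_in_monomial_ideal_iff)
      with polys.subset_adjoin[OF id] show ?thesis by blast
    next
      case False
      then have "pvar i * monom (e - Poly_Mapping.single i 1) = (monom e :: 'a mpoly)"
        using eV by (simp add: pvar_def mult_single exp_split_var[simplified])
      moreover have "monom (e - Poly_Mapping.single i 1) \<in> polys Z"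
        using eZ keys_diff_exp by (intro single_in_polys) fast
      ultimately show ?thesis using polys.mult_in_adjoin[OF id] by metis
    qed
  qed
qed

section \<open>Elementary symmetric polynomials as a regular sequence\<close>

definition total_degree :: "nat \<Rightarrow> (nat \<Rightarrow>\<^sub>0 nat) \<Rightarrow> nat" where
  "total_degree n e = (\<Sum>i\<in>{1..n}. Poly_Mapping.lookup e i)"

definition homogeneous :: "nat \<Rightarrow> nat \<Rightarrow> 'k::field mpoly \<Rightarrow> bool" where
  "homogeneous n k p \<longleftrightarrow> (\<forall>e\<in>Poly_Mapping.keys p. total_degree n e = k)"

definition hom_component :: "nat \<Rightarrow> nat \<Rightarrow> 'k::field mpoly \<Rightarrow> 'k mpoly" where
  "hom_component n d = restrict_keys {e. total_degree n e = d}"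

definition graded_ideal :: "nat \<Rightarrow> 'k::field mpoly set \<Rightarrow> bool" where
  "graded_ideal n I \<longleftrightarrow> (\<forall>p\<in>I. \<forall>d. hom_component n d p \<in> I)"

lemma total_degree_add: "total_degree n (e + f) = total_degree n e + total_degree n f"
  by (simp add: total_degree_def lookup_add sum.distrib)

lemma homogeneous_mult:
  assumes "homogeneous n k p" "homogeneous n l q" shows "homogeneous n (k + l) (p * q)"
  unfolding homogeneous_def
proof
  fix e assume "e \<in> Poly_Mapping.keys (p * q)"
  then obtain a b where "e = a + b" "a \<in> Poly_Mapping.keys p" "b \<in> Poly_Mapping.keys q"
    using keys_mult[of p q] by blast
  then show "total_degree n e = k + l" using assms by (simp add: homogeneous_def total_degree_add)
qed

lemma homogeneous_1: "homogeneous n 0 1"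
  by (simp add: homogeneous_def total_degree_def)

lemma homogeneous_pvar: "i \<in> {1..n} \<Longrightarrow> homogeneous n 1 (pvar i)"
  by (simp add: homogeneous_def total_degree_def pvar_def lookup_single when_def)

lemma homogeneous_power: "homogeneous n k p \<Longrightarrow> homogeneous n (m * k) (p ^ m)"
  by (induction m) (auto simp: homogeneous_1 homogeneous_mult)

lemma homogeneous_sum:
  assumes "\<And>i. i \<in> A \<Longrightarrow> homogeneous n k (f i)" shows "homogeneous n k (sum f A)"
  using Poly_Mapping.keys_sum[of f A] assms by (auto simp: homogeneous_def)

lemma homogeneous_prod_pvar:
  assumes "T \<subseteq> {1..n}" shows "homogeneous n (card T) (\<Prod>i\<in>T. pvar i)"
proof -
  have "finite T" using assms finite_subset by blast
  then show ?thesis using assms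
  proof (induction T)
    case (insert i T)
    then show ?case using homogeneous_mult[OF homogeneous_pvar[of i n], of "card T" "\<Prod>i\<in>T. pvar i"]
      by simp
  qed (simp add: homogeneous_1)
qed

lemma hom_component_add: "hom_component n d (p + q) = hom_component n d p + hom_component n d q"
  by (simp add: hom_component_def restrict_add)

lemma hom_component_mult:
  assumes "homogeneous n k a"
  shows "hom_component n d (a * p) = (if k \<le> d then a * hom_component n (d - k) p else 0)"
proof (cases "k \<le> d")
  case True
  define r where "r = restrict_keys (- {e. total_degree n e = d - k}) p"
  have "homogeneous n (d - k) (hom_component n (d - k) p)"
    by (simp add: homogeneous_def hom_component_def keys_restrict)
  from homogeneous_mult[OF assms this]
  have "hom_component n d (a * hom_component n (d - k) p) = a * hom_component n (d - k) p"
    using True unfolding hom_component_def by (intro restrict_eq_self) (auto simp: homogeneous_def)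
  moreover have "hom_component n d (a * r) = 0"
    unfolding hom_component_def
  proof (rule restrict_eq_0, rule ccontr)
    assume "Poly_Mapping.keys (a * r) \<inter> {e. total_degree n e = d} \<noteq> {}"
    then obtain e where "e \<in> Poly_Mapping.keys (a * r)" "total_degree n e = d" by blast
    moreover from this keys_mult[of a r] obtain f g where
      "e = f + g" "f \<in> Poly_Mapping.keys a" "g \<in> Poly_Mapping.keys r" by blast
    ultimately show False
      using assms True by (auto simp: homogeneous_def total_degree_add r_def keys_restrict)
  qed
  moreover have "a * p = a * hom_component n (d - k) p + a * r"
    by (simp add: r_def hom_component_def restrict_compl flip: distrib_left)
  ultimately show ?thesis using True by (simp add: hom_component_add)
next
  case False
  have "hom_component n d (a * p) = 0"
    unfolding hom_component_def
  proof (rule restrict_eq_0, rule ccontr)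
    assume "Poly_Mapping.keys (a * p) \<inter> {e. total_degree n e = d} \<noteq> {}"
    then obtain e where "e \<in> Poly_Mapping.keys (a * p)" "total_degree n e = d" by blast
    moreover from this keys_mult[of a p] obtain f g where
      "e = f + g" "f \<in> Poly_Mapping.keys a" "g \<in> Poly_Mapping.keys p" by blast
    ultimately show False
      using assms False by (auto simp: homogeneous_def total_degree_add)
  qed
  with False show ?thesis by simp
qed

lemma sum_hom_component:
  "p = (\<Sum>d\<in>total_degree n ` Poly_Mapping.keys p. hom_component n d p)"
proof (rule poly_mapping_eqI)
  fix e
  show "Poly_Mapping.lookup p e = Poly_Mapping.lookup
      (\<Sum>d\<in>total_degree n ` Poly_Mapping.keys p. hom_component n d p) e"
    by (cases "e \<in> Poly_Mapping.keys p")
       (auto simp: lookup_sum hom_component_def lookup_restrict when_def in_keys_iff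
         intro!: sum.neutral)
qed

lemma hom_component_in_polys: "p \<in> polys Z \<Longrightarrow> hom_component n d p \<in> polys Z"
  by (simp add: hom_component_def restrict_in_polys)

lemma graded_monomial_ideal: "graded_ideal n (monomial_ideal Z U)"
  by (auto simp: graded_ideal_def monomial_ideal_def hom_component_in_polys)
     (auto simp: hom_component_def keys_restrict)

lemma graded_adjoin:
  assumes "ideal_in (polys Z) I" "graded_ideal n I" "homogeneous n k a"
  shows "graded_ideal n (adjoin (polys Z) I a)"
  unfolding graded_ideal_def
proof (intro ballI allI)
  fix p d assume "p \<in> adjoin (polys Z) I a"
  then obtain q y where *: "q \<in> I" "y \<in> polys Z" "p = q + a * y" by (rule adjoinE)
  have "hom_component n d q \<in> I" using * assms by (simp add: graded_ideal_def)
  then show "hom_component n d p \<in> adjoin (polys Z) I a"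
    using * polys.subset_adjoin[OF assms(1), of a]
    by (auto simp: hom_component_add hom_component_mult[OF assms(3)]
        intro!: adjoinI hom_component_in_polys)
qed

text \<open>The graded form of Nakayama's lemma: an element that lies in \<open>I + x\<^sub>i\<^sup>k S\<close> for every
  \<open>k\<close> lies in \<open>I\<close>.\<close>

lemma weakly_regular_lift:
  assumes "ideal_in (polys {1..n}) I" "graded_ideal n I" "i \<in> {1..n}"
    and "nzd_mod (polys {1..n}) I (pvar i)"
    and "\<And>a. a \<in> set as \<Longrightarrow> a \<in> polys {1..n} \<and> (\<exists>k. homogeneous n k a)"
    and "weakly_regular (polys {1..n}) (adjoin (polys {1..n}) I (pvar i)) as"
  shows "weakly_regular (polys {1..n}) I as"
  using assms
proof (induction as arbitrary: I)
  case (Cons a as)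
  let ?C = "polys {1..n}" and ?x = "pvar i"
  note I = Cons.prems(1)
  have x: "?x \<in> ?C" using assms(3) by simp
  obtain k where a: "a \<in> ?C" "homogeneous n k a" using Cons.prems(5)[of a] by auto
  have nzd_x: "\<And>g. g \<in> ?C \<Longrightarrow> ?x * g \<in> I \<Longrightarrow> g \<in> I" using Cons.prems(4) by (auto simp: nzd_mod_def)
  have nzd: "nzd_mod ?C I a"
    unfolding nzd_mod_def
  proof (intro ballI impI)
    fix f assume f: "f \<in> ?C" "a * f \<in> I"
    \<comment> \<open>Invariant of repeated division by the variable \<open>x\<close>:
      \<open>g\<close> lies in \<open>I + xS\<close> because \<open>a\<close> is regular modulo that
      ideal, and \<open>x\<close> is cancelled from \<open>x * (a * h)\<close> because it is regular
      modulo \<open>I\<close>.\<close>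
    have step: "\<exists>p\<in>I. \<exists>g\<in>?C. f = p + ?x ^ m * g \<and> a * g \<in> I" for m
    proof (induction m)
      case 0
      show ?case using f polys.ideal_zero[OF I] by (intro bexI[of _ 0] bexI[of _ f]) auto
    next
      case (Suc m)
      then obtain p g where pg: "p \<in> I" "g \<in> ?C" "f = p + ?x ^ m * g" "a * g \<in> I" by blast
      have "g \<in> adjoin ?C I ?x"
        using Cons.prems(6) pg polys.subset_adjoin[OF I, of ?x] by (auto simp: nzd_mod_def)
      then obtain q h where qh: "q \<in> I" "h \<in> ?C" "g = q + ?x * h" by (rule adjoinE)
      have "?x * (a * h) = a * g - a * q" using qh by (simp add: algebra_simps)
      then have "?x * (a * h) \<in> I"
        using pg qh a polys.ideal_mult[OF I] by (auto intro: polys.ideal_diff[OF I])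
      then have "a * h \<in> I" using nzd_x a qh by blast
      moreover have "p + ?x ^ m * q \<in> I"
        using pg qh x by (intro polys.ideal_add[OF I] polys.ideal_mult[OF I] polys.power_closed)
      moreover have "f = (p + ?x ^ m * q) + ?x ^ Suc m * h"
        using pg qh by (simp add: algebra_simps)
      ultimately show ?case using qh by blast
    qed
    \<comment> \<open>A multiple of the power \<open>d + 1\<close> of the variable has no component
      of degree \<open>d\<close>, so this component comes from \<open>p\<close> alone.\<close>
    have "hom_component n d f \<in> I" for d
    proof -
      obtain p g where pg: "p \<in> I" "g \<in> ?C" "f = p + ?x ^ Suc d * g" using step[of "Suc d"] by blast
      have "hom_component n d (?x ^ Suc d * g) = 0"
        using hom_component_mult[OF homogeneous_power[OF homogeneous_pvar[OF assms(3)]], of d "Suc d" g]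
        by (simp del: power_Suc)
      then have "hom_component n d f = hom_component n d p" using pg by (simp add: hom_component_add)
      with pg Cons.prems(2) show ?thesis by (simp add: graded_ideal_def)
    qed
    then show "f \<in> I" by (subst sum_hom_component[of _ n]) (rule polys.ideal_sum[OF I])
  qed
  have "weakly_regular ?C (adjoin ?C I a) as"
  proof (rule Cons.IH)
    show "ideal_in ?C (adjoin ?C I a)" by (rule polys.ideal_in_adjoin[OF I a(1)])
    show "graded_ideal n (adjoin ?C I a)" by (rule graded_adjoin[OF I Cons.prems(2) a(2)])
    show "nzd_mod ?C (adjoin ?C I a) ?x"
      using polys.nzd_mod_adjoin[OF I x a(1) Cons.prems(4)] Cons.prems(6) by simp
    show "weakly_regular ?C (adjoin ?C (adjoin ?C I a) ?x) as"
      unfolding polys.adjoin_commute[of _ I a] using Cons.prems(6) by simp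
  qed (use Cons.prems in auto)
  with nzd show ?case by simp
qed auto

section \<open>Elementary symmetric polynomials modulo ideals generated by variables\<close>

definition esym :: "nat \<Rightarrow> nat \<Rightarrow> 'k::field mpoly" where
  "esym n r = (\<Sum>T | T \<subseteq> {1..n} \<and> card T = r. \<Prod>i\<in>T. pvar i)"

abbreviation esyms :: "nat \<Rightarrow> nat \<Rightarrow> 'k::field mpoly list" where
  "esyms n r \<equiv> map (esym n) [1..<Suc r]"

lemma esym_in_polys: "esym n r \<in> polys {1..n}"
  unfolding esym_def by (intro polys.sum_closed polys.prod_closed) auto

lemma homogeneous_esym: "homogeneous n r (esym n r)"
  unfolding esym_def
proof (rule homogeneous_sum)
  fix T assume "T \<in> {T. T \<subseteq> {1..n} \<and> card T = r}"
  then show "homogeneous n r (\<Prod>i\<in>T. pvar i)" using homogeneous_prod_pvar[of T n] by auto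
qed

text \<open>These are the exponents in the prime ideal \<open>(x_i : i in W)\<close>. Killing
  variables inside a fixed ring avoids a change to \<open>K[Z]\<close>, so one list of elements is
  used throughout.\<close>

definition meets :: "nat set \<Rightarrow> (nat \<Rightarrow>\<^sub>0 nat) set" where
  "meets W = {e. \<exists>i\<in>W. Poly_Mapping.lookup e i > 0}"

lemma meets_insert: "meets (insert i W) = meets W \<union> {e. Poly_Mapping.lookup e i > 0}"
  by (auto simp: meets_def)

lemma upward_closed_meets: "upward_closed Z (meets W)"
  by (fastforce simp: upward_closed_def meets_def lookup_add)

lemma nzd_pvar_meets:
  assumes "i \<notin> W"
  shows "nzd_mod (polys Z) (monomial_ideal Z (meets W)) (pvar i)"
  unfolding nzd_mod_def
proof (intro ballI impI)
  fix f :: "'a mpoly" assume f: "f \<in> polys Z" "pvar i * f \<in> monomial_ideal Z (meets W)"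
  have "e \<in> meets W" if "e \<in> Poly_Mapping.keys f" for e
  proof -
    have "Poly_Mapping.single i 1 + e \<in> meets W"
      using f that by (auto simp: monomial_ideal_def keys_pvar_mult)
    then obtain j where "j \<in> W" "Poly_Mapping.lookup (Poly_Mapping.single i 1 + e) j > 0"
      by (auto simp: meets_def)
    moreover from this have "i \<noteq> j" using assms by blast
    ultimately show ?thesis
      by (auto simp: meets_def lookup_add lookup_single when_def)
  qed
  then show "f \<in> monomial_ideal Z (meets W)" using f by (auto simp: monomial_ideal_def)
qed

lemma prod_pvar_in_meets:
  assumes "T \<subseteq> Z" "finite T" "i \<in> T" "i \<in> W"
  shows "(\<Prod>j\<in>T. pvar j) \<in> monomial_ideal Z (meets W)"
proof -
  note id = ideal_in_monomial_ideal[OF upward_closed_meets]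
  have "pvar i \<in> monomial_ideal Z (meets W)"
    using assms by (auto simp: pvar_def monomial_ideal_def in_polys_iff meets_def intro!: bexI[of _ i])
  moreover have "(\<Prod>j\<in>T - {i}. pvar j) \<in> polys Z" using assms by (intro polys.prod_closed) auto
  ultimately have "pvar i * (\<Prod>j\<in>T - {i}. pvar j) \<in> monomial_ideal Z (meets W)"
    by (rule polys.ideal_mult'[OF id])
  then show ?thesis using assms by (simp flip: prod.remove)
qed

text \<open>If \<open>r\<close> variables are left outside \<open>W\<close>, then \<open>e\<^sub>r\<close> is their product modulo \<open>(x\<^sub>i : i \<in> W)\<close>,
  and each of them is a nonzerodivisor modulo \<open>e\<^sub>1, \<dots>, e\<^sub>r\<^sub>-\<^sub>1\<close>; if more variables are left, one of
  them can be added to \<open>W\<close>.\<close>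

lemma weakly_regular_esyms_meets:
  assumes "W \<subseteq> {1..n}" "r \<le> n - card W"
  shows "weakly_regular (polys {1..n}) (monomial_ideal {1..n} (meets W)) (esyms n r :: 'k::field mpoly list)"
  using assms
proof (induction "n - card W" arbitrary: W r rule: less_induct)
  case less
  let ?C = "polys {1..n} :: 'k mpoly set"
  let ?I = "\<lambda>W. monomial_ideal {1..n} (meets W) :: 'k mpoly set"
  have fin: "finite W" using less.prems finite_subset by blast
  have I: "ideal_in ?C (?I W)" by (rule ideal_in_monomial_ideal[OF upward_closed_meets])
  have es: "a \<in> ?C \<and> (\<exists>k. homogeneous n k a)" if "a \<in> set (esyms n m)" for a :: "'k mpoly" and m
    using that esym_in_polys homogeneous_esym unfolding set_map by blast
  have quot: "weakly_regular ?C (adjoin ?C (?I W) (pvar i)) (esyms n m)"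
    if "i \<in> {1..n} - W" "m < n - card W" for i m
  proof -
    have "adjoin ?C (?I W) (pvar i) = ?I (insert i W)"
      using that by (simp add: adjoin_pvar_monomial_ideal[OF _ upward_closed_meets] meets_insert)
    moreover have "card (insert i W) = Suc (card W)" using that fin by simp
    ultimately show ?thesis using less.hyps[of "insert i W" m] that less.prems(1) by simp
  qed
  \<comment> \<open>With fewer polynomials than remaining variables, one more variable is killed and
    regularity is lifted back through it.\<close>
  have lift: "weakly_regular ?C (?I W) (esyms n m)" if "m < n - card W" for m
  proof -
    have "card ({1..n} - W) \<noteq> 0" using that less.prems fin by (simp add: card_Diff_subset)
    then obtain i where "i \<in> {1..n} - W" by (metis all_not_in_conv card.empty)
    then have i: "i \<in> {1..n}" "i \<notin> W" and q: "weakly_regular ?C (adjoin ?C (?I W) (pvar i)) (esyms n m)"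
      using quot that by blast+
    show ?thesis
      by (rule weakly_regular_lift[OF I graded_monomial_ideal i(1) nzd_pvar_meets[OF i(2)] es q])
  qed
  show ?case
  proof (cases "r < n - card W \<or> r = 0")
    case True
    then show ?thesis using lift[of r] by fastforce
  next
    case False
    then obtain m where m: "r = Suc m" "r = n - card W" using less.prems by (cases r) auto
    define B where "B = foldl (adjoin ?C) (?I W) (esyms n m)"
    have setC: "set (esyms n m) \<subseteq> ?C" using es by blast
    have B: "ideal_in ?C B" unfolding B_def by (rule polys.ideal_in_foldl_adjoin[OF I setC])
    have "?I W \<subseteq> foldl (adjoin ?C) (?I W) as" if "set as \<subseteq> ?C" for as
      using that
    proof (induction as rule: rev_induct)
      case (snoc a as)
      then have "ideal_in ?C (foldl (adjoin ?C) (?I W) as)"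
        by (intro polys.ideal_in_foldl_adjoin[OF I]) auto
      from polys.subset_adjoin[OF this] snoc show ?case by fastforce
    qed simp
    then have sub: "?I W \<subseteq> B" unfolding B_def using setC .
    \<comment> \<open>After killing one more variable there are still \<open>m\<close> left, so the
      first \<open>m\<close> polynomials stay regular; hence the variable is a nonzerodivisor modulo
      \<open>B\<close>.\<close>
    have "nzd_mod ?C B (pvar i)" if "i \<in> {1..n} - W" for i
      unfolding B_def
    proof (rule polys.nzd_mod_foldl_adjoin[OF I _ setC])
      show "nzd_mod ?C (?I W) (pvar i)" using that by (intro nzd_pvar_meets) blast
      show "weakly_regular ?C (adjoin ?C (?I W) (pvar i)) (esyms n m)" using quot that m by simp
    qed (use that in simp)
    then have nzd: "nzd_mod ?C B (\<Prod>i\<in>{1..n} - W. pvar i)"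
      by (intro polys.nzd_mod_prod) auto
    define A where "A = {T. T \<subseteq> {1..n} \<and> card T = r}"
    have A: "finite A" "{1..n} - W \<in> A"
      using m fin less.prems by (auto simp: A_def card_Diff_subset)
    have rest: "(\<Sum>T\<in>A - {{1..n} - W}. \<Prod>i\<in>T. pvar i) \<in> ?I W"
    proof (rule polys.ideal_sum[OF I])
      fix T assume T: "T \<in> A - {{1..n} - W}"
      then have finT: "T \<subseteq> {1..n}" "finite T" by (auto simp: A_def intro: finite_subset)
      \<comment> \<open>Having \<open>r\<close> elements, \<open>T\<close> could fit into the
        complement of \<open>W\<close> only by being equal to it.\<close>
      have "\<not> T \<subseteq> {1..n} - W"
      proof
        assume "T \<subseteq> {1..n} - W"
        moreover have "card T = card ({1..n} - W)" using T A(2) by (auto simp: A_def)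
        ultimately have "T = {1..n} - W" by (intro card_subset_eq) auto
        with T show False by blast
      qed
      then show "(\<Prod>i\<in>T. pvar i) \<in> ?I W" using finT prod_pvar_in_meets by blast
    qed
    have esym: "esym n r = (\<Prod>i\<in>{1..n} - W. pvar i) + (\<Sum>T\<in>A - {{1..n} - W}. \<Prod>i\<in>T. pvar i)"
      unfolding esym_def using sum.remove[OF A] by (simp add: A_def)
    have "nzd_mod ?C B (esym n r)"
      unfolding nzd_mod_def
    proof (intro ballI impI)
      fix f assume f: "f \<in> ?C" "esym n r * f \<in> B"
      have "esym n r * f - (\<Prod>i\<in>{1..n} - W. pvar i) * f
          = (\<Sum>T\<in>A - {{1..n} - W}. \<Prod>i\<in>T. pvar i) * f"
        by (simp add: esym algebra_simps)
      also have "\<dots> \<in> B" using polys.ideal_mult'[OF I rest f(1)] sub by blast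
      finally have "(\<Prod>i\<in>{1..n} - W. pvar i) * f \<in> B" using polys.ideal_cong[OF B] f by blast
      with nzd f show "f \<in> B" by (auto simp: nzd_mod_def)
    qed
    then show ?thesis using lift[of m] m by (simp add: weakly_regular_append B_def)
  qed
qed

text \<open>Truncated subtraction supplies the maximum with \<open>0\<close>. The bounds
  \<open>c\<close> vary because the colon by \<open>x_i\<close> lowers \<open>c i\<close> by one;
  powers of the path ideal have \<open>c\<close> constantly \<open>t\<close>.\<close>

definition deficit_set :: "nat \<Rightarrow> nat \<Rightarrow> (nat \<Rightarrow> nat) \<Rightarrow> (nat \<Rightarrow>\<^sub>0 nat) set" where
  "deficit_set n t c = {e. (\<Sum>i\<in>{1..n}. c i - Poly_Mapping.lookup e i) \<le> t}"

lemma upward_closed_deficit_set: "upward_closed Z (deficit_set n t c)"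
  unfolding upward_closed_def deficit_set_def
  by (auto simp: lookup_add intro!: diff_le_mono2 elim!: order.trans[OF sum_mono, rotated])

lemma upward_closed_Un: "upward_closed Z U \<Longrightarrow> upward_closed Z V \<Longrightarrow> upward_closed Z (U \<union> V)"
  by (auto simp: upward_closed_def)

text \<open>The measure is the sum of \<open>c\<close> over the variables not yet killed: the colon
  lowers one value, killing a variable removes a positive one. Branching stops at the prime ideal of
  \<open>W\<close> once the bounds on \<open>W\<close> sum to more than \<open>t\<close>, or at the
  unit ideal when all bounds outside \<open>W\<close> are \<open>0\<close>.\<close>

lemma weakly_regular_esyms_deficit_meets:
  assumes "W \<subseteq> {1..n}" "\<And>i. i \<in> W \<Longrightarrow> c i \<ge> 1" "card W \<le> Suc t"
  shows "weakly_regular (polys {1..n}) (monomial_ideal {1..n} (meets W \<union> deficit_set n t c))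
           (esyms n (n - 1 - t) :: 'k::field mpoly list)"
  using assms
proof (induction "\<Sum>i\<in>{1..n} - W. c i" arbitrary: W c rule: less_induct)
  case less
  let ?C = "polys {1..n} :: 'k mpoly set" and ?es = "esyms n (n - 1 - t) :: 'k mpoly list"
  let ?I = "\<lambda>W c. monomial_ideal {1..n} (meets W \<union> deficit_set n t c) :: 'k mpoly set"
  have fin: "finite W" using less.prems finite_subset by blast
  have up: "upward_closed {1..n} (meets W \<union> deficit_set n t c)" for W c
    by (intro upward_closed_Un upward_closed_meets upward_closed_deficit_set)
  have split: "sum f {1..n} = sum f W + sum f ({1..n} - W)" for f :: "nat \<Rightarrow> nat"
    using less.prems by (metis add.commute finite_atLeastAtMost sum.subset_diff)
  have es: "set ?es \<subseteq> ?C" using esym_in_polys by auto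
  consider (prime) "sum c W > t" | (unit) "sum c W \<le> t" "\<forall>i\<in>{1..n} - W. c i = 0"
    | (branch) i where "sum c W \<le> t" "i \<in> {1..n} - W" "c i > 0"
    by (metis gr0I not_le)
  then show ?case
  proof cases
    case prime
    have "e \<in> meets W" if "e \<in> deficit_set n t c" for e
    proof (rule ccontr)
      assume "e \<notin> meets W"
      then have "(\<Sum>i\<in>W. c i - Poly_Mapping.lookup e i) = sum c W" by (auto simp: meets_def intro: sum.cong)
      with that prime split[of "\<lambda>i. c i - Poly_Mapping.lookup e i"] show False
        by (simp add: deficit_set_def)
    qed
    then have "meets W \<union> deficit_set n t c = meets W" by blast
    moreover have "n - 1 - t \<le> n - card W" using less.prems(3) by simp
    ultimately show ?thesis using weakly_regular_esyms_meets[OF less.prems(1)] by metis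
  next
    case unit
    have "(\<Sum>i\<in>{1..n}. c i - Poly_Mapping.lookup e i) \<le> sum c {1..n}" for e
      by (intro sum_mono) auto
    moreover have "sum c {1..n} \<le> t" using unit split[of c] by simp
    ultimately have "deficit_set n t c = UNIV" by (auto simp: deficit_set_def intro: order.trans)
    then have "?I W c = ?C" by (auto simp: monomial_ideal_def)
    moreover have "weakly_regular ?C ?C as" if "set as \<subseteq> ?C" for as
      using that
    proof (induction as)
      case (Cons a as)
      have id: "ideal_in ?C ?C" by (auto simp: ideal_in_def)
      have "adjoin ?C ?C a \<subseteq> ?C" using Cons.prems by (auto elim!: adjoinE)
      with polys.subset_adjoin[OF id, of a] have "adjoin ?C ?C a = ?C" by blast
      with Cons show ?case by (simp add: nzd_mod_def)
    qed simp
    ultimately show ?thesis using es by metis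
  next
    case branch
    have iC: "pvar i \<in> ?C" using branch by simp
    let ?c' = "c(i := c i - 1)"
    have rem: "sum f ({1..n} - W) = f i + sum f ({1..n} - insert i W)" for f :: "nat \<Rightarrow> nat"
    proof -
      have "{1..n} - W - {i} = {1..n} - insert i W" by blast
      then show ?thesis using branch sum.remove[of "{1..n} - W" i f] by simp
    qed
    have "(\<Sum>j\<in>{1..n} - insert i W. ?c' j) = (\<Sum>j\<in>{1..n} - insert i W. c j)"
      by (rule sum.cong) auto
    then have decr: "sum ?c' ({1..n} - W) < sum c ({1..n} - W)" "sum c ({1..n} - insert i W) < sum c ({1..n} - W)"
      using branch rem[of ?c'] rem[of c] by auto
    \<comment> \<open>Branching happens only while \<open>sum c W\<close> is at most
      \<open>t\<close>, so \<open>W\<close> has at most \<open>t\<close> elements before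
      \<open>i\<close> joins it.\<close>
    have "card W \<le> sum c W" using less.prems sum_mono[of W "\<lambda>_. 1" c] by simp
    then have cardW: "card (insert i W) \<le> Suc t" using branch fin by simp
    have "Poly_Mapping.single i 1 + e \<in> meets W \<union> deficit_set n t c \<longleftrightarrow> e \<in> meets W \<union> deficit_set n t ?c'" for e
    proof -
      have "c j - Poly_Mapping.lookup (Poly_Mapping.single i 1 + e) j = ?c' j - Poly_Mapping.lookup e j" for j
        by (simp add: lookup_add lookup_single when_def)
      then have "Poly_Mapping.single i 1 + e \<in> deficit_set n t c \<longleftrightarrow> e \<in> deficit_set n t ?c'"
        by (simp only: deficit_set_def mem_Collect_eq)
      moreover have "Poly_Mapping.single i 1 + e \<in> meets W \<longleftrightarrow> e \<in> meets W"
        using branch by (auto simp: meets_def lookup_add lookup_single when_def)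
      ultimately show ?thesis by blast
    qed
    then have "{e. Poly_Mapping.single i 1 + e \<in> meets W \<union> deficit_set n t c}
        = meets W \<union> deficit_set n t ?c'" by blast
    then have "{g \<in> ?C. pvar i * g \<in> ?I W c} = ?I W ?c'"
      using branch(2) by (subst monomial_ideal_colon) (blast, simp only:)
    moreover have "weakly_regular ?C (?I W ?c') ?es"
      by (rule less.hyps[OF decr(1) less.prems(1) _ less.prems(3)]) (use less.prems(2) branch in auto)
    moreover have "adjoin ?C (?I W c) (pvar i) = ?I (insert i W) c"
      using branch(2) adjoin_pvar_monomial_ideal[where 'a = 'k, OF _ up[of W c], of i]
      unfolding meets_insert by (simp only: Un_ac Diff_iff)
    moreover have "weakly_regular ?C (?I (insert i W) c) ?es"
      by (rule less.hyps[OF decr(2) _ _ cardW]) (use less.prems branch in auto)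
    ultimately show ?thesis
      using polys.weakly_regular_colon[OF ideal_in_monomial_ideal[OF up] iC es] by simp
  qed
qed

lemma weakly_regular_esyms_deficit:
  "weakly_regular (polys {1..n}) (monomial_ideal {1..n} (deficit_set n t (\<lambda>_. t)))
     (esyms n (n - 1 - t) :: 'k::field mpoly list)"
  using weakly_regular_esyms_deficit_meets[of "{}" n "\<lambda>_. t" t] by (simp add: meets_def)

section \<open>Koszul cohomology\<close>

definition koszul_sign :: "nat \<Rightarrow> nat set \<Rightarrow> 'a::comm_ring_1" where
  "koszul_sign i T = (- 1) ^ card {k \<in> T. k < i}"

text \<open>Exterior multiplication by the vector of the \<open>x i\<close>, without exterior
  powers: a cochain is a function on sets of indices, and its degree is the size of the sets at
  which it is read.\<close>

definition koszul_d :: "(nat \<Rightarrow> 'a::comm_ring_1) \<Rightarrow> (nat set \<Rightarrow> 'a) \<Rightarrow> nat set \<Rightarrow> 'a" where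
  "koszul_d x \<phi> T = (\<Sum>i\<in>T. koszul_sign i T * (x i * \<phi> (T - {i})))"

text \<open>The interior product with a coordinate vector, which provides the homotopies for
  \<open>koszul_d\<close>.\<close>

definition koszul_contract :: "nat \<Rightarrow> (nat set \<Rightarrow> 'a::comm_ring_1) \<Rightarrow> nat set \<Rightarrow> 'a" where
  "koszul_contract i \<phi> T = (if i \<in> T then 0 else koszul_sign i T * \<phi> (insert i T))"

lemma koszul_sign_sq: "koszul_sign i T * (koszul_sign i T * a) = a"
  by (simp add: koszul_sign_def flip: mult.assoc power_add)

lemma koszul_sign_insert:
  assumes "finite T" "k \<notin> T"
  shows "koszul_sign i (insert k T) = (if k < i then - koszul_sign i T else koszul_sign i T)"
proof -
  have "{l \<in> insert k T. l < i} = (if k < i then insert k {l \<in> T. l < i} else {l \<in> T. l < i})" by auto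
  then show ?thesis using assms by (simp add: koszul_sign_def)
qed

lemma koszul_sign_remove:
  assumes "finite T" "k \<in> T"
  shows "koszul_sign i (T - {k}) =
    (if k < i then - koszul_sign i T else koszul_sign i T :: 'a::comm_ring_1)"
  using koszul_sign_insert[where 'a = 'a, of "T - {k}" k i] assms by (simp add: insert_absorb split: if_splits)

text \<open>Pairs cancel one by one in an induction on \<open>T\<close>; showing only that twice the
  sum vanishes would not suffice in characteristic 2.\<close>

lemma sum_antisymmetric:
  fixes h :: "'b \<Rightarrow> 'b \<Rightarrow> 'a::comm_ring_1"
  assumes "finite T" "\<And>i k. i \<in> T \<Longrightarrow> k \<in> T \<Longrightarrow> i \<noteq> k \<Longrightarrow> h i k = - h k i"
  shows "(\<Sum>i\<in>T. \<Sum>k\<in>T - {i}. h i k) = 0"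
  using assms
proof (induction T)
  case (insert a T)
  have "(\<Sum>k\<in>insert a T - {i}. h i k) = h i a + (\<Sum>k\<in>T - {i}. h i k)" if "i \<in> T" for i
  proof -
    have "insert a T - {i} = insert a (T - {i})" using that insert.hyps by blast
    then show ?thesis using insert.hyps by simp
  qed
  moreover have "insert a T - {a} = T" using insert.hyps by blast
  ultimately have "(\<Sum>i\<in>insert a T. \<Sum>k\<in>insert a T - {i}. h i k) =
      (\<Sum>k\<in>T. h a k) + ((\<Sum>i\<in>T. h i a) + (\<Sum>i\<in>T. \<Sum>k\<in>T - {i}. h i k))"
    using insert.hyps by (simp add: sum.distrib)
  also have "(\<Sum>i\<in>T. h i a) = - (\<Sum>k\<in>T. h a k)"
    unfolding sum_negf[symmetric]
  proof (rule sum.cong)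
    fix i assume i: "i \<in> T"
    show "h i a = - h a i" by (rule insert.prems) (use i insert.hyps in auto)
  qed simp
  also have "(\<Sum>i\<in>T. \<Sum>k\<in>T - {i}. h i k) = 0"
    by (rule insert.IH) (rule insert.prems, auto)
  finally show ?case by simp
qed simp

lemma koszul_d_d: assumes "finite T" shows "koszul_d x (koszul_d x \<phi>) T = 0"
proof -
  define h where "h i k = koszul_sign i T * koszul_sign k (T - {i}) * (x i * x k * \<phi> (T - {i, k}))" for i k
  have "koszul_d x (koszul_d x \<phi>) T = (\<Sum>i\<in>T. \<Sum>k\<in>T - {i}. h i k)"
    unfolding koszul_d_def h_def
    by (simp add: sum_distrib_left mult_ac Diff_insert2[symmetric] insert_commute)
  also have "\<dots> = 0"
  proof (rule sum_antisymmetric[OF assms])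
    fix i k assume "i \<in> T" "k \<in> T" "i \<noteq> k"
    with assms show "h i k = - h k i"
      by (auto simp: h_def koszul_sign_remove insert_commute mult_ac)
  qed
  finally show ?thesis .
qed

text \<open>If \<open>i\<close> is in \<open>T\<close>, only the summand at \<open>i\<close> of the
  first term survives. Otherwise removing \<open>k\<close> and contracting by \<open>i\<close>
  anticommute, which leaves the summand at \<open>i\<close> of the second term. Hence each
  \<open>x i\<close> annihilates Koszul cohomology.\<close>

lemma koszul_homotopy:
  assumes "finite T"
  shows "koszul_d x (koszul_contract i \<phi>) T + koszul_contract i (koszul_d x \<phi>) T = x i * \<phi> T"
proof (cases "i \<in> T")
  case True
  have "koszul_d x (koszul_contract i \<phi>) T =
      koszul_sign i T * (x i * koszul_contract i \<phi> (T - {i})) +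
      (\<Sum>k\<in>T - {i}. koszul_sign k T * (x k * koszul_contract i \<phi> (T - {k})))"
    unfolding koszul_d_def by (rule sum.remove[OF assms True])
  also have "(\<Sum>k\<in>T - {i}. koszul_sign k T * (x k * koszul_contract i \<phi> (T - {k}))) = 0"
    using True by (intro sum.neutral) (auto simp: koszul_contract_def)
  also have "koszul_contract i \<phi> (T - {i}) = koszul_sign i T * \<phi> T"
    using True assms by (simp add: koszul_contract_def koszul_sign_remove insert_absorb)
  also have "koszul_sign i T * (x i * (koszul_sign i T * \<phi> T)) = x i * \<phi> T"
    using koszul_sign_sq[of i T "x i * \<phi> T"] by (simp add: mult_ac)
  finally have "koszul_d x (koszul_contract i \<phi>) T = x i * \<phi> T" by simp
  moreover have "koszul_contract i (koszul_d x \<phi>) T = 0" using True by (simp add: koszul_contract_def)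
  ultimately show ?thesis by simp
next
  case False
  have "koszul_contract i (koszul_d x \<phi>) T = koszul_sign i T * (koszul_sign i (insert i T) *
      (x i * \<phi> T) + (\<Sum>k\<in>T. koszul_sign k (insert i T) * (x k * \<phi> (insert i T - {k}))))"
    using False assms by (simp add: koszul_contract_def koszul_d_def)
  also have "\<dots> = x i * \<phi> T +
      (\<Sum>k\<in>T. koszul_sign i T * (koszul_sign k (insert i T) * (x k * \<phi> (insert i T - {k}))))"
    using False assms by (simp add: koszul_sign_insert distrib_left sum_distrib_left koszul_sign_sq)
  also have "(\<Sum>k\<in>T. koszul_sign i T * (koszul_sign k (insert i T) * (x k * \<phi> (insert i T - {k})))) =
      - koszul_d x (koszul_contract i \<phi>) T"
    unfolding koszul_d_def sum_negf[symmetric]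
  proof (rule sum.cong)
    fix k assume k: "k \<in> T"
    then have ne: "i \<noteq> k" using False by blast
    then have "insert i T - {k} = insert i (T - {k})" by blast
    with k ne False assms
    show "koszul_sign i T * (koszul_sign k (insert i T) * (x k * \<phi> (insert i T - {k}))) =
      - (koszul_sign k T * (x k * koszul_contract i \<phi> (T - {k})))"
      by (auto simp: koszul_contract_def koszul_sign_remove koszul_sign_insert mult_ac)
  qed simp
  finally show ?thesis by simp
qed

context subring_of_type
begin

text \<open>\<open>koszul_nonzero n x j B\<close> says that the Koszul cohomology \<open>H\<^sup>j(x\<^sub>1,\<dots>,x\<^sub>n; C/B)\<close> does not vanish;
  a cochain of degree \<open>j\<close> is a function on the subsets of \<open>{1..n}\<close> of size \<open>j\<close>.\<close>

definition koszul_nonzero :: "nat \<Rightarrow> (nat \<Rightarrow> 'a) \<Rightarrow> nat \<Rightarrow> 'a set \<Rightarrow> bool" where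
  "koszul_nonzero n x j B \<longleftrightarrow> (\<exists>\<phi>. range \<phi> \<subseteq> C \<and>
     (\<forall>T\<subseteq>{1..n}. card T = Suc j \<longrightarrow> koszul_d x \<phi> T \<in> B) \<and>
     \<not> (\<exists>\<psi>. range \<psi> \<subseteq> C \<and> (\<forall>T\<subseteq>{1..n}. card T = j \<longrightarrow> \<phi> T - koszul_d x \<psi> T \<in> B)))"

lemma koszul_sign_closed [simp]: "koszul_sign i T \<in> C"
  by (simp add: koszul_sign_def)

text \<open>The connecting map \<open>H\<^sup>j(C/(B + aC)) \<rightarrow> H\<^sup>j\<^sup>+\<^sup>1(C/B)\<close> is onto, because its cokernel embeds
  in \<open>H\<^sup>j\<^sup>+\<^sup>1(C/B)\<close> via multiplication by \<open>a\<close>, which is null-homotopic.\<close>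

lemma koszul_nonzero_adjoin:
  assumes B: "ideal_in C B" and x: "\<And>i. i \<in> {1..n} \<Longrightarrow> x i \<in> C"
    and y: "\<And>i. i \<in> {1..n} \<Longrightarrow> y i \<in> C" and a: "a = (\<Sum>i\<in>{1..n}. y i * x i)"
    and nzd: "nzd_mod C B a" and nonzero: "koszul_nonzero n x (Suc j) B"
  shows "koszul_nonzero n x j (adjoin C B a)"
proof -
  obtain \<phi> where \<phi>: "range \<phi> \<subseteq> C"
    and cocycle: "\<And>T. T \<subseteq> {1..n} \<Longrightarrow> card T = Suc (Suc j) \<Longrightarrow> koszul_d x \<phi> T \<in> B"
    and not_cob: "\<And>\<psi>. range \<psi> \<subseteq> C \<Longrightarrow>
      \<exists>T\<subseteq>{1..n}. card T = Suc j \<and> \<phi> T - koszul_d x \<psi> T \<notin> B"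
    using nonzero unfolding koszul_nonzero_def by metis
  have fin: "finite T" if "T \<subseteq> {1..n}" for T using that finite_subset by blast
  have \<phi>C [simp]: "\<phi> T \<in> C" for T using \<phi> by blast
  have aC: "a \<in> C" unfolding a using x y by auto
  \<comment> \<open>The homotopy for multiplication by \<open>a\<close>, assembled from those for
    the \<open>x i\<close>. As \<open>\<phi>\<close> is a cocycle modulo \<open>B\<close>, the
    coboundary of \<open>\<eta>\<close> agrees with \<open>a * \<phi>\<close> modulo
    \<open>B\<close>.\<close>
  define \<eta> where "\<eta> T = (\<Sum>i\<in>{1..n}. y i * koszul_contract i \<phi> T)" for T
  have \<eta>C: "range \<eta> \<subseteq> C"
    using y by (auto simp: \<eta>_def koszul_contract_def intro!: sum_closed)
  have d_\<eta>: "koszul_d x \<eta> T = (\<Sum>i\<in>{1..n}. y i * koszul_d x (koszul_contract i \<phi>) T)" for T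
    unfolding koszul_d_def \<eta>_def sum_distrib_left
    by (subst sum.swap) (simp add: mult_ac)
  have d_\<eta>_cong: "koszul_d x \<eta> T - a * \<phi> T \<in> B" if T: "T \<subseteq> {1..n}" "card T = Suc j" for T
  proof -
    have "koszul_d x \<eta> T - a * \<phi> T = (\<Sum>i\<in>{1..n}. y i * (- koszul_contract i (koszul_d x \<phi>) T))"
      unfolding d_\<eta> a sum_distrib_right sum_subtractf[symmetric]
    proof (rule sum.cong)
      fix i
      show "y i * koszul_d x (koszul_contract i \<phi>) T - y i * x i * \<phi> T =
          y i * (- koszul_contract i (koszul_d x \<phi>) T)"
        using koszul_homotopy[OF fin[OF T(1)], of x i \<phi>] by (simp add: algebra_simps flip: distrib_left)
    qed simp
    also have "\<dots> \<in> B"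
    proof (intro ideal_sum[OF B] ideal_mult[OF B] ideal_uminus[OF B] y)
      fix i assume i: "i \<in> {1..n}"
      show "koszul_contract i (koszul_d x \<phi>) T \<in> B"
        unfolding koszul_contract_def
        using i T fin[OF T(1)] by (auto intro!: ideal_zero[OF B] ideal_mult[OF B] cocycle)
    qed
    finally show ?thesis .
  qed
  have \<eta>_cocycle: "koszul_d x \<eta> T \<in> adjoin C B a" if "T \<subseteq> {1..n}" "card T = Suc j" for T
    using adjoinI[OF d_\<eta>_cong[OF that] \<phi>C[of T], of a] by simp
  have \<eta>_not_cob: "\<not> (\<forall>T\<subseteq>{1..n}. card T = j \<longrightarrow> \<eta> T - koszul_d x \<psi> T \<in> adjoin C B a)"
    if \<psi>: "range \<psi> \<subseteq> C" for \<psi>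
  proof
    assume "\<forall>T\<subseteq>{1..n}. card T = j \<longrightarrow> \<eta> T - koszul_d x \<psi> T \<in> adjoin C B a"
    then have "\<forall>T. \<exists>c\<in>C. T \<subseteq> {1..n} \<longrightarrow> card T = j \<longrightarrow> (\<eta> T - koszul_d x \<psi> T) - a * c \<in> B"
      by (metis (no_types, lifting) add_diff_cancel_right' adjoinE zero_closed)
    then obtain \<chi> where \<chi>: "\<And>T. \<chi> T \<in> C"
      "\<And>T. T \<subseteq> {1..n} \<Longrightarrow> card T = j \<Longrightarrow> (\<eta> T - koszul_d x \<psi> T) - a * \<chi> T \<in> B"
      by metis
    obtain T where T: "T \<subseteq> {1..n}" "card T = Suc j" "\<phi> T - koszul_d x \<chi> T \<notin> B"
      using not_cob[of \<chi>] \<chi> by blast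
    \<comment> \<open>\<open>koszul_d\<close> is applied to
      \<open>\<eta> - koszul_d x \<psi> - a * \<chi>\<close>, which has values in \<open>B\<close>
      on sets of size \<open>j\<close>; the middle term vanishes by
      \<open>koszul_d_d\<close>.\<close>
    have "(\<Sum>i\<in>T. koszul_sign i T * (x i * ((\<eta> (T - {i}) - koszul_d x \<psi> (T - {i})) - a * \<chi> (T - {i})))) \<in> B"
      using T fin[OF T(1)] x by (intro ideal_sum[OF B] ideal_mult[OF B] \<chi>) auto
    also have "(\<Sum>i\<in>T. koszul_sign i T * (x i * ((\<eta> (T - {i}) - koszul_d x \<psi> (T - {i})) - a * \<chi> (T - {i})))) =
        koszul_d x \<eta> T - koszul_d x (koszul_d x \<psi>) T - a * koszul_d x \<chi> T"
      unfolding koszul_d_def[of x \<eta>] koszul_d_def[of x \<chi>] koszul_d_def[of x "koszul_d x \<psi>"]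
      by (simp add: algebra_simps sum_subtractf sum.distrib sum_distrib_left)
    finally have "koszul_d x \<eta> T - a * koszul_d x \<chi> T \<in> B"
      by (simp add: koszul_d_d[OF fin[OF T(1)]])
    from ideal_diff[OF B this d_\<eta>_cong[OF T(1,2)]] have "a * (\<phi> T - koszul_d x \<chi> T) \<in> B"
      by (simp add: algebra_simps)
    moreover have "koszul_d x \<chi> T \<in> C"
      unfolding koszul_d_def using T x \<chi> by (intro sum_closed mult_closed) auto
    ultimately show False using nzd T by (simp add: nzd_mod_def)
  qed
  show ?thesis
    unfolding koszul_nonzero_def using \<eta>C \<eta>_cocycle \<eta>_not_cob by blast
qed

text \<open>In degree \<open>0\<close> a nonzero class is a socle element of \<open>C/B\<close>;
  every combination of the \<open>x i\<close> kills it, so none is a nonzerodivisor and the sequence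
  cannot outlast the degree.\<close>

lemma weakly_regular_length_le:
  assumes "ideal_in C B" "\<And>i. i \<in> {1..n} \<Longrightarrow> x i \<in> C" "koszul_nonzero n x j B"
    and "weakly_regular C B as"
    and "\<And>a. a \<in> set as \<Longrightarrow> \<exists>y. (\<forall>i\<in>{1..n}. y i \<in> C) \<and> a = (\<Sum>i\<in>{1..n}. y i * x i)"
  shows "length as \<le> j"
  using assms
proof (induction as arbitrary: B j)
  case (Cons a as)
  note B = Cons.prems(1) and x = Cons.prems(2)
  have nzd: "nzd_mod C B a" using Cons.prems(4) by simp
  obtain y where y: "\<And>i. i \<in> {1..n} \<Longrightarrow> y i \<in> C" "a = (\<Sum>i\<in>{1..n}. y i * x i)"
    using Cons.prems(5)[of a] by (metis list.set_intros(1))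
  show ?case
  proof (cases j)
    case 0
    then obtain \<phi> where \<phi>: "range \<phi> \<subseteq> C"
      and cocycle: "\<And>T. T \<subseteq> {1..n} \<Longrightarrow> card T = Suc 0 \<Longrightarrow> koszul_d x \<phi> T \<in> B"
      and not_cob: "\<And>\<psi>. range \<psi> \<subseteq> C \<Longrightarrow> \<exists>T\<subseteq>{1..n}. card T = 0 \<and> \<phi> T - koszul_d x \<psi> T \<notin> B"
      using Cons.prems(3) unfolding koszul_nonzero_def by metis
    have "x i * \<phi> {} \<in> B" if "i \<in> {1..n}" for i
    proof -
      have "{k \<in> {i}. k < i} = {}" by auto
      then have "koszul_sign i {i} = (1 :: 'a)" by (simp only: koszul_sign_def card.empty power_0)
      then show ?thesis using cocycle[of "{i}"] that by (simp add: koszul_d_def)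
    qed
    then have "y i * (x i * \<phi> {}) \<in> B" if "i \<in> {1..n}" for i
      using that y ideal_mult[OF B] by blast
    then have "(\<Sum>i\<in>{1..n}. y i * (x i * \<phi> {})) \<in> B" by (intro ideal_sum[OF B])
    then have "a * \<phi> {} \<in> B" by (simp add: y(2) sum_distrib_right mult.assoc)
    then have "\<phi> {} \<in> B" using nzd \<phi> by (auto simp: nzd_mod_def)
    moreover obtain T where "T \<subseteq> {1..n}" "card T = 0" "\<phi> T - koszul_d x (\<lambda>_. 0) T \<notin> B"
      using not_cob[of "\<lambda>_. 0"] by auto
    moreover from this have "T = {}" using finite_subset by fastforce
    ultimately show ?thesis by (simp add: koszul_d_def)
  next
    case (Suc j')
    have aC: "a \<in> C" unfolding y(2) using x y(1) by auto
    have "length as \<le> j'"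
    proof (rule Cons.IH[OF ideal_in_adjoin[OF B aC] x])
      show "koszul_nonzero n x j' (adjoin C B a)"
        using koszul_nonzero_adjoin[OF B x y nzd] Cons.prems(3) Suc by simp
      show "weakly_regular C (adjoin C B a) as" using Cons.prems(4) by simp
    qed (use Cons.prems(5) in auto)
    then show ?thesis using Suc by simp
  qed
qed simp

end

section \<open>A nonzero Koszul class for monomial ideals\<close>

definition indicator_exp :: "nat set \<Rightarrow> nat \<Rightarrow>\<^sub>0 nat" where
  "indicator_exp T = (\<Sum>i\<in>T. Poly_Mapping.single i 1)"

lemma lookup_indicator_exp:
  "finite T \<Longrightarrow> Poly_Mapping.lookup (indicator_exp T) i = (if i \<in> T then 1 else 0)"
  by (simp add: indicator_exp_def lookup_sum lookup_single when_def)

lemma keys_indicator_exp: "finite T \<Longrightarrow> Poly_Mapping.keys (indicator_exp T) = T"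
  by (rule Set.set_eqI) (simp add: in_keys_iff lookup_indicator_exp)

lemma indicator_exp_remove:
  "finite T \<Longrightarrow> i \<in> T \<Longrightarrow> Poly_Mapping.single i 1 + indicator_exp (T - {i}) = indicator_exp T"
  unfolding indicator_exp_def by (rule sum.remove[symmetric])

lemma lookup_koszul_sign_mult:
  fixes p :: "'k::field mpoly"
  shows "Poly_Mapping.lookup (koszul_sign i T * p) e = koszul_sign i T * Poly_Mapping.lookup p e"
  by (cases "even (card {k \<in> T. k < i})") (auto simp: koszul_sign_def)

text \<open>In the multidegrees \<open>e + indicator_exp T\<close> the complex is the cochain complex of the
  skeleton of a simplex; the cochain concentrated in one facet is not a coboundary, because it
  does not vanish on the boundary of a larger simplex.\<close>

lemma koszul_nonzero_monomial_ideal: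
  assumes up: "upward_closed {1..n} U" and j: "j < n" and e: "Poly_Mapping.keys e \<subseteq> {1..n}"
    and U: "\<And>T. T \<subseteq> {1..n} \<Longrightarrow> e + indicator_exp T \<in> U \<longleftrightarrow> j < card T"
  shows "polys.koszul_nonzero {1..n} n pvar j (monomial_ideal {1..n} U :: 'k::field mpoly set)"
proof -
  let ?I = "monomial_ideal {1..n} U :: 'k mpoly set"
  have I: "ideal_in (polys {1..n}) ?I" by (rule ideal_in_monomial_ideal[OF up])
  \<comment> \<open>A set of \<open>j\<close> indices that misses \<open>n\<close>, as
    \<open>j < n\<close>; \<open>insert n Z\<close> becomes the larger simplex.\<close>
  define Z where "Z = {1..j}"
  have Z: "Z \<subseteq> {1..n}" "card Z = j" "n \<notin> Z" using j by (auto simp: Z_def)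
  define \<phi> :: "nat set \<Rightarrow> 'k mpoly" where
    "\<phi> T = (if T = Z then monom (e + indicator_exp Z) else 0)" for T
  have fin: "finite T" if "T \<subseteq> {1..n}" for T using that finite_subset by blast
  have keys: "Poly_Mapping.keys (e + indicator_exp T) \<subseteq> {1..n}" if "T \<subseteq> {1..n}" for T
    using that e fin[OF that] by (simp add: keys_exp_add keys_indicator_exp)
  have "range \<phi> \<subseteq> polys {1..n}"
    using keys[OF Z(1)] by (auto simp: \<phi>_def single_in_polys)
  moreover have "koszul_d pvar \<phi> T \<in> ?I" if T: "T \<subseteq> {1..n}" "card T = Suc j" for T
    unfolding koszul_d_def
  proof (rule polys.ideal_sum[OF I], rule polys.ideal_mult[OF I])
    fix i assume i: "i \<in> T"
    show "pvar i * \<phi> (T - {i}) \<in> ?I"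
    proof (cases "T - {i} = Z")
      case True
      have "pvar i * \<phi> (T - {i}) = monom (e + indicator_exp T)"
        unfolding \<phi>_def True using indicator_exp_remove[OF fin[OF T(1)] i] True
        by (simp add: pvar_def mult_single add.left_commute)
      moreover have "monom (e + indicator_exp T) \<in> ?I"
        using keys[OF T(1)] U[OF T(1)] T(2) by (simp add: monom_in_monomial_ideal_iff)
      ultimately show ?thesis by simp
    next
      case False
      then show ?thesis using polys.ideal_zero[OF I] by (simp add: \<phi>_def del: One_nat_def)
    qed
  qed simp
  moreover have False
    if \<psi>: "\<forall>T\<subseteq>{1..n}. card T = j \<longrightarrow> \<phi> T - koszul_d pvar \<psi> T \<in> ?I" for \<psi>
  proof -
    define Y where "Y = insert n Z"
    have Y: "Y \<subseteq> {1..n}" "finite Y" using Z j by (auto simp: Y_def Z_def)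
    have cardY: "card (Y - {i}) = j" if "i \<in> Y" for i
      using that Z Y by (simp add: Y_def Z_def)
    \<comment> \<open>Facets of \<open>Y\<close> have \<open>j\<close> elements, so their
      multidegrees lie outside \<open>U\<close>, and congruence modulo the ideal is equality of the
      coefficients there.\<close>
    have coeff: "Poly_Mapping.lookup (koszul_sign i Y * (pvar i * koszul_d pvar \<psi> (Y - {i}))) (e + indicator_exp Y)
        = (if i = n then koszul_sign n Y else 0)" if i: "i \<in> Y" for i
    proof -
      have sub: "Y - {i} \<subseteq> {1..n}" using Y by blast
      have "e + indicator_exp (Y - {i}) \<notin> U" using U[OF sub] cardY[OF i] by simp
      moreover have "\<phi> (Y - {i}) - koszul_d pvar \<psi> (Y - {i}) \<in> ?I" using \<psi> sub cardY[OF i] by blast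
      ultimately have "Poly_Mapping.lookup (\<phi> (Y - {i}) - koszul_d pvar \<psi> (Y - {i})) (e + indicator_exp (Y - {i})) = 0"
        by (auto simp: monomial_ideal_def simp flip: not_in_keys_iff_lookup_eq_zero)
      then have "Poly_Mapping.lookup (koszul_d pvar \<psi> (Y - {i})) (e + indicator_exp (Y - {i}))
          = Poly_Mapping.lookup (\<phi> (Y - {i})) (e + indicator_exp (Y - {i}))"
        by (simp add: lookup_minus)
      also have "\<dots> = (if i = n then 1 else 0)"
      proof -
        have "Y - {i} = Z \<longleftrightarrow> i = n" using i Z by (auto simp: Y_def)
        then show ?thesis by (auto simp: \<phi>_def)
      qed
      finally have "Poly_Mapping.lookup (pvar i * koszul_d pvar \<psi> (Y - {i}))
          (Poly_Mapping.single i 1 + (e + indicator_exp (Y - {i}))) = (if i = n then 1 else 0)"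
        by (simp add: pvar_def lookup_single_mult)
      moreover have "Poly_Mapping.single i 1 + (e + indicator_exp (Y - {i})) = e + indicator_exp Y"
        using indicator_exp_remove[OF Y(2) i] by (simp add: add.left_commute)
      ultimately show ?thesis by (simp add: lookup_koszul_sign_mult)
    qed
    \<comment> \<open>In the vanishing double coboundary on \<open>Y\<close> only the facet
      \<open>Z\<close> contributes, namely a sign, which is not zero in a field.\<close>
    have "0 = Poly_Mapping.lookup (koszul_d pvar (koszul_d pvar \<psi>) Y) (e + indicator_exp Y)"
      by (simp add: koszul_d_d[OF Y(2)])
    also have "\<dots> = (\<Sum>i\<in>Y. if i = n then koszul_sign n Y else 0)"
      unfolding koszul_d_def[of _ "koszul_d pvar \<psi>"] lookup_sum
      by (rule sum.cong) (simp_all only: coeff)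
    also have "\<dots> = koszul_sign n Y" using Y by (simp add: Y_def)
    finally show False by (simp add: koszul_sign_def)
  qed
  ultimately show ?thesis unfolding polys.koszul_nonzero_def by blast
qed

section \<open>Powers of the path ideal\<close>

lemma ideal_in_genideal:
  assumes "G \<subseteq> polys Z"
  shows "ideal_in (polys Z) (genideal (mpoly_ring Z) G)"
  using ring.genideal_ideal[OF cring.axioms(1)[OF mpoly_ring_cring] assms]
  by (simp add: ideal_mpoly_ring_iff)

lemma genideal_subset:
  assumes "ideal_in (polys Z) I" "G \<subseteq> I"
  shows "genideal (mpoly_ring Z) G \<subseteq> I"
  using ring.genideal_minimal[OF cring.axioms(1)[OF mpoly_ring_cring] _ assms(2)] assms(1)
  by (simp add: ideal_mpoly_ring_iff)

lemma generators_in_genideal: "G \<subseteq> polys Z \<Longrightarrow> G \<subseteq> genideal (mpoly_ring Z) G"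
  by (rule ring.genideal_self[OF cring.axioms(1)[OF mpoly_ring_cring]])

lemma pvars_subset: "pvar ` {1..n} \<subseteq> polys {1..n}"
  by auto

text \<open>The linear combinations of the variables form an ideal, so minimality of
  \<open>genideal\<close> applies. They are the form in which
  \<open>weakly_regular_length_le\<close> takes its elements.\<close>

lemma graded_max_ideal_span:
  fixes a :: "'k::field mpoly"
  assumes "a \<in> graded_max_ideal n"
  shows "\<exists>y. (\<forall>i\<in>{1..n}. y i \<in> polys {1..n}) \<and> a = (\<Sum>i\<in>{1..n}. y i * pvar i)"
proof -
  let ?C = "polys {1..n} :: 'k mpoly set"
  define D where "D = {\<Sum>i\<in>{1..n}. y i * pvar i | y :: nat \<Rightarrow> 'k mpoly. \<forall>i\<in>{1..n}. y i \<in> ?C}"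
  have D: "ideal_in ?C D"
    unfolding ideal_in_def
  proof (intro conjI ballI subsetI)
    fix p assume "p \<in> D"
    then show "p \<in> ?C" by (auto simp: D_def intro!: polys.sum_closed)
  next
    show "0 \<in> D" unfolding D_def by (auto intro!: exI[of _ "\<lambda>_. 0"])
  next
    fix p q assume "p \<in> D" "q \<in> D"
    then obtain y z where "\<forall>i\<in>{1..n}. y i \<in> ?C" "\<forall>i\<in>{1..n}. z i \<in> ?C"
      "p = (\<Sum>i\<in>{1..n}. y i * pvar i)" "q = (\<Sum>i\<in>{1..n}. z i * pvar i)" by (auto simp: D_def)
    then show "p + q \<in> D" unfolding D_def
      by (auto simp: distrib_right sum.distrib intro!: exI[of _ "\<lambda>i. y i + z i"])
  next
    fix p c assume "p \<in> D" "c \<in> ?C"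
    then obtain y where "\<forall>i\<in>{1..n}. y i \<in> ?C" "p = (\<Sum>i\<in>{1..n}. y i * pvar i)"
      by (auto simp: D_def)
    with \<open>c \<in> ?C\<close> show "c * p \<in> D" unfolding D_def
      by (auto simp: sum_distrib_left mult.assoc intro!: exI[of _ "\<lambda>i. c * y i"])
  qed
  have "pvar i \<in> D" if "i \<in> {1..n}" for i
  proof -
    have "pvar i = (\<Sum>k\<in>{1..n}. (if k = i then 1 else 0) * (pvar k :: 'k mpoly))"
      using that by (simp add: if_distrib[of "\<lambda>c. c * _"] cong: if_cong)
    then show ?thesis unfolding D_def by (auto intro!: exI[of _ "\<lambda>k. if k = i then 1 else 0"])
  qed
  then have "graded_max_ideal n \<subseteq> D"
    unfolding graded_max_ideal_def by (intro genideal_subset[OF D]) auto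
  then show ?thesis using assms by (auto simp: D_def)
qed

lemma graded_max_ideal_lookup_0:
  assumes "a \<in> graded_max_ideal n" shows "Poly_Mapping.lookup a 0 = 0"
proof -
  have "Poly_Mapping.lookup (y * pvar i) 0 = 0" for y :: "'a mpoly" and i
  proof -
    have "Poly_Mapping.single i 1 + e \<noteq> 0" for e :: "nat \<Rightarrow>\<^sub>0 nat"
      by (metis add_is_0 lookup_add lookup_single_eq lookup_zero one_neq_zero)
    then have "0 \<notin> Poly_Mapping.keys (pvar i * y)" by (auto simp: keys_pvar_mult dest: sym)
    then show ?thesis by (simp add: in_keys_iff mult.commute)
  qed
  then show ?thesis using graded_max_ideal_span[OF assms] by (auto simp: lookup_sum)
qed

lemma ideal_in_graded_max_ideal: "ideal_in (polys {1..n}) (graded_max_ideal n)"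
  unfolding graded_max_ideal_def by (rule ideal_in_genideal[OF pvars_subset])

lemma esym_in_graded_max_ideal:
  assumes "r \<ge> 1" shows "esym n r \<in> graded_max_ideal n"
  unfolding esym_def
proof (rule polys.ideal_sum[OF ideal_in_graded_max_ideal])
  fix T assume T: "T \<in> {T. T \<subseteq> {1..n} \<and> card T = r}"
  then have "T \<noteq> {}" "finite T" using assms by (auto intro: finite_subset)
  then obtain i where i: "i \<in> T" by blast
  have "pvar i \<in> graded_max_ideal n"
    using generators_in_genideal[OF pvars_subset] T i unfolding graded_max_ideal_def by blast
  moreover have "(\<Prod>j\<in>T - {i}. pvar j) \<in> polys {1..n}" using T by (intro polys.prod_closed) auto
  ultimately have "pvar i * (\<Prod>j\<in>T - {i}. pvar j) \<in> graded_max_ideal n"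
    by (rule polys.ideal_mult'[OF ideal_in_graded_max_ideal])
  then show "(\<Prod>i\<in>T. pvar i) \<in> graded_max_ideal n"
    using prod.remove[OF \<open>finite T\<close> i, of pvar] by metis
qed

section \<open>Generators of the path ideal\<close>

lemma prod_pvar: "finite T \<Longrightarrow> (\<Prod>i\<in>T. pvar i) = monom (indicator_exp T)"
  by (induction T rule: finite_induct) (simp_all add: indicator_exp_def pvar_def mult_single)

text \<open>Nonzero differences within the interval are below \<open>n\<close>, hence not divisible
  by \<open>n\<close>; surjectivity follows by counting.\<close>

lemma cyclic_interval:
  fixes i n :: nat
  assumes "i \<ge> 1" "n \<ge> 1"
  shows "inj_on (\<lambda>k. (k - 1) mod n + 1) {i..<i + n}"
    and "(\<lambda>k. (k - 1) mod n + 1) ` {i..<i + n} = {1..n}"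
proof -
  show inj: "inj_on (\<lambda>k. (k - 1) mod n + 1) {i..<i + n}"
  proof (rule linorder_inj_onI')
    fix k l assume kl: "k \<in> {i..<i + n}" "l \<in> {i..<i + n}" "k < l"
    show "(k - 1) mod n + 1 \<noteq> (l - 1) mod n + 1"
    proof
      assume "(k - 1) mod n + 1 = (l - 1) mod n + 1"
      then have "(l - 1) mod n = (k - 1) mod n" by simp
      then have "n dvd (l - 1) - (k - 1)" using kl assms by (subst (asm) mod_eq_dvd_iff_nat) auto
      then have "n \<le> (l - 1) - (k - 1)" using kl assms by (intro dvd_imp_le) auto
      then show False using kl assms by auto
    qed
  qed
  have "(\<lambda>k. (k - 1) mod n + 1) ` {i..<i + n} \<subseteq> {1..n}"
    using assms by (auto simp: Suc_le_eq)
  moreover have "card ((\<lambda>k. (k - 1) mod n + 1) ` {i..<i + n}) = card {1..n}"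
    by (subst card_image[OF inj]) simp
  ultimately show "(\<lambda>k. (k - 1) mod n + 1) ` {i..<i + n} = {1..n}"
    by (intro card_subset_eq) auto
qed

text \<open>A path of \<open>n - 1\<close> consecutive indices lacks one index of a full turn: the
  one that would come next.\<close>

lemma path_generator:
  assumes "i \<ge> 1" "n \<ge> 1"
  shows "(\<Prod>k = i..<i + (n - 1). pvar ((k - 1) mod n + 1)) =
     (monom (indicator_exp ({1..n} - {(i + (n - 1) - 1) mod n + 1})) :: 'k::field mpoly)"
proof -
  let ?f = "\<lambda>k. (k - 1) mod n + 1"
  have split: "{i..<i + n} = insert (i + (n - 1)) {i..<i + (n - 1)}" using assms by auto
  have inj: "inj_on ?f {i..<i + (n - 1)}"
    using cyclic_interval(1)[OF assms] by (rule inj_on_subset) auto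
  have "{i..<i + (n - 1)} - {i + (n - 1)} = {i..<i + (n - 1)}" by auto
  then have "?f (i + (n - 1)) \<notin> ?f ` {i..<i + (n - 1)}"
    using cyclic_interval(1)[OF assms] unfolding split inj_on_insert by metis
  moreover have "insert (?f (i + (n - 1))) (?f ` {i..<i + (n - 1)}) = {1..n}"
    using cyclic_interval(2)[OF assms] unfolding split image_insert .
  ultimately have "?f ` {i..<i + (n - 1)} = {1..n} - {?f (i + (n - 1))}" by blast
  moreover have "(\<Prod>k = i..<i + (n - 1). pvar (?f k)) = (\<Prod>j\<in>?f ` {i..<i + (n - 1)}. pvar j :: 'k mpoly)"
    by (subst prod.reindex[OF inj]) (simp add: comp_def)
  ultimately show ?thesis by (simp only: prod_pvar finite_Diff finite_atLeastAtMost)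
qed

lemma path_generators:
  assumes "n \<ge> 1"
  shows "(\<lambda>i. \<Prod>k = i..<i + (n - 1). pvar ((k - 1) mod n + 1)) ` {1..n} =
    (\<lambda>m. monom (indicator_exp ({1..n} - {m})) :: 'k::field mpoly) ` {1..n}" (is "?A = ?B")
proof -
  let ?h = "\<lambda>i. (i + (n - 1) - 1) mod n + 1"
  have "?h i \<in> {1..n}" for i using assms by (simp add: Suc_le_eq)
  \<comment> \<open>The path omitting \<open>m\<close> starts right after it, at
    \<open>m + 1\<close>, or at \<open>1\<close> if \<open>m = n\<close>.\<close>
  moreover have "\<exists>i\<in>{1..n}. m = ?h i" if "m \<in> {1..n}" for m
  proof (cases "m = n")
    case True
    then show ?thesis using assms by (intro bexI[of _ 1]) auto
  next
    case False
    then have "m - 1 < n" using that by auto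
    then have "(m - 1 + n) mod n = m - 1" by (simp only: mod_add_self2 mod_less)
    moreover have "m + 1 + (n - 1) - 1 = m - 1 + n" using that by auto
    ultimately show ?thesis using that False by (intro bexI[of _ "m + 1"]) auto
  qed
  ultimately have "?h ` {1..n} = {1..n}" by blast
  have "?A = (\<lambda>m. monom (indicator_exp ({1..n} - {m}))) ` (?h ` {1..n})"
    unfolding image_image using path_generator[OF _ assms] by (intro image_cong) auto
  with \<open>?h ` {1..n} = {1..n}\<close> show ?thesis by simp
qed

section \<open>The path ideal and its powers in terms of deficits\<close>

lemma exp_add_diff:
  fixes e f :: "nat \<Rightarrow>\<^sub>0 nat"
  assumes "\<And>i. Poly_Mapping.lookup f i \<le> Poly_Mapping.lookup e i"
  shows "f + (e - f) = e"
  by (rule poly_mapping_eqI) (use assms in \<open>simp add: lookup_add lookup_minus\<close>)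

lemma cycle_path_ideal_eq:
  assumes "n \<ge> 1"
  shows "cycle_path_ideal n (n - 1) =
    (monomial_ideal {1..n} (deficit_set n 1 (\<lambda>_. 1)) :: 'k::field mpoly set)"
proof -
  let ?g = "\<lambda>m. monom (indicator_exp ({1..n} - {m})) :: 'k mpoly"
  let ?M = "monomial_ideal {1..n} (deficit_set n 1 (\<lambda>_. 1)) :: 'k mpoly set"
  let ?J = "genideal (mpoly_ring {1..n}) (?g ` {1..n})"
  have g: "?g ` {1..n} \<subseteq> polys {1..n}"
    by (auto intro!: single_in_polys simp: keys_indicator_exp)
  note J = ideal_in_genideal[OF g]
  have "indicator_exp ({1..n} - {m}) \<in> deficit_set n 1 (\<lambda>_. 1)" for m
  proof -
    have "(\<Sum>i\<in>{1..n}. 1 - Poly_Mapping.lookup (indicator_exp ({1..n} - {m})) i) =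
      (\<Sum>i\<in>{1..n}. if i = m then 1 else 0)"
      by (rule sum.cong) (auto simp: lookup_indicator_exp)
    also have "\<dots> \<le> 1" by simp
    finally show ?thesis unfolding deficit_set_def by simp
  qed
  then have "?g ` {1..n} \<subseteq> ?M"
    by (auto simp: monom_in_monomial_ideal_iff keys_indicator_exp)
  then have "?J \<subseteq> ?M"
    by (intro genideal_subset ideal_in_monomial_ideal upward_closed_deficit_set)
  moreover have "?M \<subseteq> ?J"
  proof
    fix p assume p: "p \<in> ?M"
    show "p \<in> ?J"
    proof (rule sum_single_in_ideal[OF J])
      show "p \<in> polys {1..n}" using p by (simp add: monomial_ideal_def)
      fix e assume "e \<in> Poly_Mapping.keys p"
      with p have e: "Poly_Mapping.keys e \<subseteq> {1..n}" "(\<Sum>i\<in>{1..n}. 1 - Poly_Mapping.lookup e i) \<le> 1"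
        by (auto simp: monomial_ideal_def in_polys_iff deficit_set_def)
      \<comment> \<open>Two zero exponents would give deficit 2, so at most one variable is missing
        from \<open>x^e\<close>.\<close>
      have "\<exists>m\<in>{1..n}. \<forall>i\<in>{1..n} - {m}. Poly_Mapping.lookup e i \<ge> 1"
      proof (rule ccontr)
        assume *: "\<not> ?thesis"
        then obtain k where k: "k \<in> {1..n}" "Poly_Mapping.lookup e k = 0"
          using assms by (metis Diff_iff One_nat_def atLeastAtMost_iff le_refl less_one not_le)
        with * obtain l where l: "l \<in> {1..n} - {k}" "Poly_Mapping.lookup e l = 0"
          by (metis less_one not_le)
        have "(\<Sum>i\<in>{k, l}. 1 - Poly_Mapping.lookup e i) \<le> (\<Sum>i\<in>{1..n}. 1 - Poly_Mapping.lookup e i)"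
          using k l by (intro sum_mono2) auto
        then show False using k l e by (simp split: if_splits)
      qed
      then obtain m where m: "m \<in> {1..n}" "\<And>i. i \<in> {1..n} - {m} \<Longrightarrow> Poly_Mapping.lookup e i \<ge> 1" by blast
      let ?f = "indicator_exp ({1..n} - {m})"
      have "?f + (e - ?f) = e"
        by (rule exp_add_diff) (use m(2) in \<open>auto simp: lookup_indicator_exp\<close>)
      then have "monom e = ?g m * monom (e - ?f)" by (simp add: mult_single)
      moreover have "?g m \<in> ?J" using generators_in_genideal[OF g] m by blast
      moreover have "monom (e - ?f) \<in> polys {1..n}"
        using e(1) keys_diff_exp by (intro single_in_polys) fast
      ultimately show "monom e \<in> ?J" using polys.ideal_mult'[OF J] by metis
    qed
  qed
  ultimately have "?J = ?M" by (rule subset_antisym)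
  then show ?thesis unfolding cycle_path_ideal_def path_generators[OF assms] .
qed

text \<open>The generator split off omits a variable of least exponent. Elsewhere exponent and bound
  both drop by one, so deficits stay the same; at \<open>m\<close> the deficit drops by one unless
  it is \<open>0\<close>, and then minimality makes all deficits \<open>0\<close>.\<close>

lemma deficit_set_split:
  assumes "n \<ge> 1" and e: "e \<in> deficit_set n (Suc t) (\<lambda>_. Suc t)"
  obtains m where "m \<in> {1..n}" "\<And>i. i \<in> {1..n} - {m} \<Longrightarrow> Poly_Mapping.lookup e i \<ge> 1"
    and "e - indicator_exp ({1..n} - {m}) \<in> deficit_set n t (\<lambda>_. t)"
proof -
  let ?d = "\<lambda>i. Suc t - Poly_Mapping.lookup e i"
  have sum_d: "(\<Sum>i\<in>{1..n}. ?d i) \<le> Suc t" using e by (simp add: deficit_set_def)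
  obtain m where m: "m \<in> {1..n}" "\<And>i. i \<in> {1..n} \<Longrightarrow> Poly_Mapping.lookup e m \<le> Poly_Mapping.lookup e i"
    using ex_min_if_finite[of "{1..n}"] assms(1) arg_min_least[of "{1..n}" _ "Poly_Mapping.lookup e"]
    by (metis arg_min_if_finite(1) atLeastAtMost_iff emptyE finite_atLeastAtMost le_refl)
  \<comment> \<open>If \<open>e\<close> vanished at \<open>i\<close>, it would vanish at
    \<open>m\<close> too by minimality, and these two deficits sum to
    \<open>2 * Suc t\<close>.\<close>
  have pos: "Poly_Mapping.lookup e i \<ge> 1" if i: "i \<in> {1..n} - {m}" for i
  proof (rule ccontr)
    assume "\<not> Poly_Mapping.lookup e i \<ge> 1"
    then have 0: "Poly_Mapping.lookup e i = 0" "Poly_Mapping.lookup e m = 0"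
      using m(2)[of i] i by auto
    have "(\<Sum>k\<in>{i, m}. ?d k) \<le> (\<Sum>k\<in>{1..n}. ?d k)" using m i by (intro sum_mono2) auto
    then show False using 0 i sum_d by auto
  qed
  let ?f = "e - indicator_exp ({1..n} - {m})"
  have f: "t - Poly_Mapping.lookup ?f i = (if i = m then ?d m - 1 else ?d i)" if "i \<in> {1..n}" for i
    using pos[of i] that by (auto simp: lookup_minus lookup_indicator_exp)
  have "(\<Sum>i\<in>{1..n}. t - Poly_Mapping.lookup ?f i) = (?d m - 1) + (\<Sum>i\<in>{1..n} - {m}. ?d i)"
    by (subst sum.remove[OF _ m(1)]) (use f m(1) in \<open>auto intro: sum.cong\<close>)
  also have "\<dots> \<le> t"
  proof (cases "?d m = 0")
    case True
    then have "?d i = 0" if "i \<in> {1..n}" for i using m(2)[OF that] by simp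
    then have "(\<Sum>i\<in>{1..n} - {m}. ?d i) = 0" by (intro sum.neutral) blast
    with True show ?thesis by linarith
  next
    case False
    then show ?thesis using sum.remove[OF _ m(1), of ?d] sum_d by simp
  qed
  finally have "?f \<in> deficit_set n t (\<lambda>_. t)" by (simp add: deficit_set_def)
  with m(1) pos show ?thesis using that by blast
qed

text \<open>One inclusion is subadditivity of deficits when exponents and bounds are added; the
  other divides each monomial by the generator from \<open>deficit_set_split\<close>.\<close>

lemma ideal_prod_deficit:
  assumes "n \<ge> 1"
  shows "ideal_prod (mpoly_ring {1..n}) (monomial_ideal {1..n} (deficit_set n t (\<lambda>_. t)))
      (monomial_ideal {1..n} (deficit_set n 1 (\<lambda>_. 1))) =
    (monomial_ideal {1..n} (deficit_set n (Suc t) (\<lambda>_. Suc t)) :: 'k::field mpoly set)"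
proof -
  let ?D = "\<lambda>t. monomial_ideal {1..n} (deficit_set n t (\<lambda>_. t)) :: 'k mpoly set"
  let ?P = "ideal_prod (mpoly_ring {1..n}) (?D t) (?D 1)"
  have D: "ideal_in (polys {1..n}) (?D t)" for t
    by (rule ideal_in_monomial_ideal[OF upward_closed_deficit_set])
  have P: "ideal_in (polys {1..n}) ?P"
    unfolding ideal_mpoly_ring_iff[symmetric]
    by (intro ring.ideal_prod_is_ideal cring.axioms(1)[OF mpoly_ring_cring])
       (unfold ideal_mpoly_ring_iff, rule D, rule D)
  have "p \<in> ?D (Suc t)" if "p \<in> ?P" for p
    using that
  proof induction
    case (prod p q)
    have "e \<in> deficit_set n (Suc t) (\<lambda>_. Suc t)" if e: "e \<in> Poly_Mapping.keys (p * q)" for e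
    proof -
      obtain a b where ab: "e = a + b" "a \<in> Poly_Mapping.keys p" "b \<in> Poly_Mapping.keys q"
        using keys_mult[of p q] e by blast
      then have "a \<in> deficit_set n t (\<lambda>_. t)" "b \<in> deficit_set n 1 (\<lambda>_. 1)"
        using prod by (auto simp: monomial_ideal_def)
      then have "(\<Sum>i\<in>{1..n}. t - Poly_Mapping.lookup a i) + (\<Sum>i\<in>{1..n}. 1 - Poly_Mapping.lookup b i) \<le> Suc t"
        unfolding deficit_set_def by simp
      moreover have "(\<Sum>i\<in>{1..n}. Suc t - Poly_Mapping.lookup e i) \<le>
          (\<Sum>i\<in>{1..n}. t - Poly_Mapping.lookup a i) + (\<Sum>i\<in>{1..n}. 1 - Poly_Mapping.lookup b i)"
        unfolding sum.distrib[symmetric] by (rule sum_mono) (simp add: ab(1) lookup_add)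
      ultimately show ?thesis unfolding deficit_set_def by simp
    qed
    then show ?case using prod by (auto simp: monomial_ideal_def)
  next
    case (sum p q)
    then show ?case using polys.ideal_add[OF D] by simp
  qed
  moreover have "p \<in> ?P" if p: "p \<in> ?D (Suc t)" for p
  proof (rule sum_single_in_ideal[OF P])
    show "p \<in> polys {1..n}" using p by (simp add: monomial_ideal_def)
    fix e assume "e \<in> Poly_Mapping.keys p"
    with p have e: "Poly_Mapping.keys e \<subseteq> {1..n}" "e \<in> deficit_set n (Suc t) (\<lambda>_. Suc t)"
      by (auto simp: monomial_ideal_def in_polys_iff)
    obtain m where m: "m \<in> {1..n}" "\<And>i. i \<in> {1..n} - {m} \<Longrightarrow> Poly_Mapping.lookup e i \<ge> 1"
      "e - indicator_exp ({1..n} - {m}) \<in> deficit_set n t (\<lambda>_. t)"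
      using deficit_set_split[OF assms e(2)] by blast
    let ?f = "indicator_exp ({1..n} - {m})"
    have "?f + (e - ?f) = e"
      by (rule exp_add_diff) (use m(2) in \<open>auto simp: lookup_indicator_exp\<close>)
    then have "monom e = monom (e - ?f) \<otimes>\<^bsub>mpoly_ring {1..n}\<^esub> (monom ?f :: 'k mpoly)"
      by (simp add: mult_single add.commute)
    moreover have "monom (e - ?f) \<in> ?D t"
      using m(3) e(1) keys_diff_exp[of e ?f] by (subst monom_in_monomial_ideal_iff) auto
    moreover have "monom ?f \<in> ?D 1"
    proof -
      have "(\<Sum>i\<in>{1..n}. 1 - Poly_Mapping.lookup ?f i) = (\<Sum>i\<in>{1..n}. if i = m then 1 else 0)"
        by (rule sum.cong) (auto simp: lookup_indicator_exp)
      also have "\<dots> \<le> 1" by simp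
      finally have "?f \<in> deficit_set n 1 (\<lambda>_. 1)" unfolding deficit_set_def by simp
      then show ?thesis by (subst monom_in_monomial_ideal_iff) (auto simp: keys_indicator_exp)
    qed
    ultimately show "monom e \<in> ?P" by (metis ideal_prod.prod)
  qed
  ultimately show ?thesis by blast
qed

lemma cycle_path_ideal_power:
  assumes "n \<ge> 1"
  shows "cycle_path_ideal n (n - 1) [^]\<^bsub>ideals_set (mpoly_ring {1..n})\<^esub> t =
    (monomial_ideal {1..n} (deficit_set n t (\<lambda>_. t)) :: 'k::field mpoly set)"
proof (induction t)
  case 0
  \<comment> \<open>The unit of ideal multiplication is the whole ring, and for \<open>t = 0\<close>
    all deficits vanish.\<close>
  show ?case by (auto simp: nat_pow_def ideals_set_def monomial_ideal_def deficit_set_def)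
next
  case (Suc t)
  have "cycle_path_ideal n (n - 1) [^]\<^bsub>ideals_set (mpoly_ring {1..n})\<^esub> Suc t =
    ideal_prod (mpoly_ring {1..n}) (cycle_path_ideal n (n - 1) [^]\<^bsub>ideals_set (mpoly_ring {1..n})\<^esub> t)
      (cycle_path_ideal n (n - 1) :: 'k mpoly set)"
    by (simp add: nat_pow_def ideals_set_def)
  also have "\<dots> = ideal_prod (mpoly_ring {1..n}) (monomial_ideal {1..n} (deficit_set n t (\<lambda>_. t)))
      (cycle_path_ideal n (n - 1))"
    unfolding Suc.IH ..
  also have "\<dots> = monomial_ideal {1..n} (deficit_set n (Suc t) (\<lambda>_. Suc t))"
    unfolding cycle_path_ideal_eq[OF assms] by (rule ideal_prod_deficit[OF assms])
  finally show ?case .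
qed

text \<open>The deficits \<open>t - e\<^sub>i\<close> are chosen positive with sum \<open>t + 1 + (n - 1 - t)\<close>; if \<open>t \<le> n - 1\<close>, all
  of them are \<open>1\<close>.\<close>

lemma deficit_set_witness:
  assumes "n \<ge> 2" "t \<ge> 1"
  obtains e where "Poly_Mapping.keys e \<subseteq> {1..n}"
    and "\<And>T. T \<subseteq> {1..n} \<Longrightarrow> e + indicator_exp T \<in> deficit_set n t (\<lambda>_. t) \<longleftrightarrow> n - 1 - t < card T"
proof -
  \<comment> \<open>For \<open>t >= n\<close> the index \<open>1\<close> absorbs the surplus with
    \<open>t + 2 - n\<close>; this is at most \<open>t\<close>, as a deficit has to be, because
    \<open>n >= 2\<close>.\<close>
  define d :: "nat \<Rightarrow> nat" where "d i = (if i = 1 then t + 2 + (n - 1 - t) - n else 1)" for i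
  define e where "e = (\<Sum>i\<in>{1..n}. Poly_Mapping.single i (t - d i))"
  have d: "1 \<le> d i" "d i \<le> t" for i using assms by (auto simp: d_def)
  have lookup_e: "Poly_Mapping.lookup e i = (if i \<in> {1..n} then t - d i else 0)" for i
    by (simp add: e_def lookup_sum lookup_single when_def)
  have "(\<Sum>i\<in>{1..n}. d i) = d 1 + (\<Sum>i\<in>{1..n} - {1}. d i)"
    using assms by (intro sum.remove) auto
  also have "(\<Sum>i\<in>{1..n} - {1}. d i) = (\<Sum>i\<in>{1..n} - {1}. 1)"
    by (rule sum.cong) (auto simp: d_def)
  also have "\<dots> = n - 1" using assms by (simp add: card_Diff_subset)
  finally have sum_d: "(\<Sum>i\<in>{1..n}. d i) = t + 1 + (n - 1 - t)"
    using assms by (simp add: d_def)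
  have "e + indicator_exp T \<in> deficit_set n t (\<lambda>_. t) \<longleftrightarrow> n - 1 - t < card T"
    if T: "T \<subseteq> {1..n}" for T
  proof -
    have fin: "finite T" using T finite_subset by blast
    \<comment> \<open>All \<open>d i\<close> are positive, so each variable in \<open>T\<close>
      lowers the total deficit by exactly one.\<close>
    have "(\<Sum>i\<in>{1..n}. t - Poly_Mapping.lookup (e + indicator_exp T) i) + (\<Sum>i\<in>{1..n}. if i \<in> T then 1 else 0)
        = (\<Sum>i\<in>{1..n}. d i)"
      unfolding sum.distrib[symmetric]
    proof (rule sum.cong)
      fix i assume "i \<in> {1..n}"
      then show "t - Poly_Mapping.lookup (e + indicator_exp T) i + (if i \<in> T then 1 else 0) = d i"
        using d[of i] by (auto simp: lookup_add lookup_e lookup_indicator_exp[OF fin])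
    qed simp
    moreover have "(\<Sum>i\<in>{1..n}. if i \<in> T then 1 else 0) = card T"
      using T by (simp add: sum.If_cases Int_absorb1)
    ultimately show ?thesis using sum_d unfolding deficit_set_def mem_Collect_eq by linarith
  qed
  moreover have "Poly_Mapping.keys e \<subseteq> {1..n}"
    by (auto simp: in_keys_iff lookup_e split: if_splits)
  ultimately show ?thesis using that by blast
qed

section \<open>Depth\<close>

context
  fixes Z :: "nat set" and I :: "'k::field mpoly set"
  assumes I: "ideal_in (polys Z) I"
begin

lemma coset_eq: "I +>\<^bsub>mpoly_ring Z\<^esub> p = (\<lambda>h. h + p) ` I"
  by (auto simp: a_r_coset_def')

lemma coset_eq_iff: "I +>\<^bsub>mpoly_ring Z\<^esub> p = I +>\<^bsub>mpoly_ring Z\<^esub> q \<longleftrightarrow> p - q \<in> I"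
proof
  assume "I +>\<^bsub>mpoly_ring Z\<^esub> p = I +>\<^bsub>mpoly_ring Z\<^esub> q"
  then have "0 + p \<in> (\<lambda>h. h + q) ` I" using polys.ideal_zero[OF I] unfolding coset_eq by blast
  then show "p - q \<in> I" by (metis (no_types, lifting) add_0 add_diff_cancel_right' imageE)
next
  assume pq: "p - q \<in> I"
  show "I +>\<^bsub>mpoly_ring Z\<^esub> p = I +>\<^bsub>mpoly_ring Z\<^esub> q"
    unfolding coset_eq
  proof (intro equalityI subsetI; elim imageE)
    fix x h assume "x = h + p" "h \<in> I"
    then show "x \<in> (\<lambda>h. h + q) ` I"
      using polys.ideal_add[OF I _ pq, of h] by (intro image_eqI[of _ _ "h + (p - q)"]) auto
  next
    fix x h assume "x = h + q" "h \<in> I"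
    then show "x \<in> (\<lambda>h. h + p) ` I"
      using polys.ideal_diff[OF I _ pq, of h] by (intro image_eqI[of _ _ "h - (p - q)"]) auto
  qed
qed

interpretation ring_hom_ring "mpoly_ring Z" "mpoly_ring Z Quot I" "(+>\<^bsub>mpoly_ring Z\<^esub>) I"
  using I by (intro ideal.rcos_ring_hom_ring) (simp add: ideal_mpoly_ring_iff)

lemma carrier_quot_module:
  "carrier (quot_module (mpoly_ring Z) I) = (\<lambda>p. I +>\<^bsub>mpoly_ring Z\<^esub> p) ` polys Z"
  by (auto simp: quot_module_def FactRing_def A_RCOSETS_def')

lemma quot_module_zero: "\<zero>\<^bsub>quot_module (mpoly_ring Z) I\<^esub> = I +>\<^bsub>mpoly_ring Z\<^esub> 0"
  using hom_zero by (simp add: quot_module_def)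

lemma quot_module_add:
  "p \<in> polys Z \<Longrightarrow> q \<in> polys Z \<Longrightarrow>
   (I +>\<^bsub>mpoly_ring Z\<^esub> p) \<oplus>\<^bsub>quot_module (mpoly_ring Z) I\<^esub> (I +>\<^bsub>mpoly_ring Z\<^esub> q) =
   I +>\<^bsub>mpoly_ring Z\<^esub> (p + q)"
  using hom_add[of p q] by (simp add: quot_module_def)

lemma quot_module_smult:
  "p \<in> polys Z \<Longrightarrow> q \<in> polys Z \<Longrightarrow>
   p \<odot>\<^bsub>quot_module (mpoly_ring Z) I\<^esub> (I +>\<^bsub>mpoly_ring Z\<^esub> q) = I +>\<^bsub>mpoly_ring Z\<^esub> (p * q)"
  using hom_mult[of p q] by (simp add: quot_module_def)

lemma module_quot_module: "module (mpoly_ring Z) (quot_module (mpoly_ring Z) I)"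
  using I by (intro quot_module_module mpoly_ring_cring) (simp add: ideal_mpoly_ring_iff)

lemma quot_module_finsum:
  assumes "finite A" "\<And>i. i \<in> A \<Longrightarrow> g i \<in> polys Z"
    and "\<And>i. i \<in> A \<Longrightarrow> y i = I +>\<^bsub>mpoly_ring Z\<^esub> g i"
  shows "(\<Oplus>\<^bsub>quot_module (mpoly_ring Z) I\<^esub>i\<in>A. y i) = I +>\<^bsub>mpoly_ring Z\<^esub> (\<Sum>i\<in>A. g i)"
proof -
  interpret M: module "mpoly_ring Z" "quot_module (mpoly_ring Z) I" by (rule module_quot_module)
  show ?thesis using assms
  proof (induction A)
    case empty
    then show ?case by (simp add: quot_module_zero)
  next
    case (insert a A)
    have "y \<in> A \<rightarrow> carrier (quot_module (mpoly_ring Z) I)" "y a \<in> carrier (quot_module (mpoly_ring Z) I)"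
      using insert.prems by (auto simp: carrier_quot_module)
    with insert show ?case by (simp add: quot_module_add polys.sum_closed)
  qed
qed

lemma seq_smult_quot_module:
  assumes "set as \<subseteq> polys Z"
  shows "seq_smult (quot_module (mpoly_ring Z) I) as =
    (\<lambda>p. I +>\<^bsub>mpoly_ring Z\<^esub> p) ` foldl (adjoin (polys Z)) I as"
proof -
  let ?M = "quot_module (mpoly_ring Z) I"
  have as: "as ! j \<in> polys Z" if "j < length as" for j using assms that by (meson nth_mem subsetD)
  show ?thesis
  proof (intro equalityI subsetI)
    fix x assume "x \<in> seq_smult ?M as"
    then obtain y where y: "y \<in> {..<length as} \<rightarrow> carrier ?M"
      "x = (\<Oplus>\<^bsub>?M\<^esub>j\<in>{..<length as}. (as ! j) \<odot>\<^bsub>?M\<^esub> y j)" by (auto simp: seq_smult_def)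
    then have "\<forall>j\<in>{..<length as}. \<exists>g\<in>polys Z. y j = I +>\<^bsub>mpoly_ring Z\<^esub> g"
      by (auto simp: carrier_quot_module Pi_iff)
    then obtain g where g: "\<And>j. j < length as \<Longrightarrow> g j \<in> polys Z"
      "\<And>j. j < length as \<Longrightarrow> y j = I +>\<^bsub>mpoly_ring Z\<^esub> g j" by (metis lessThan_iff)
    have "x = I +>\<^bsub>mpoly_ring Z\<^esub> (\<Sum>j<length as. as ! j * g j)"
      unfolding y(2) using g as by (intro quot_module_finsum) (auto simp: quot_module_smult)
    moreover have "(\<Sum>j<length as. as ! j * g j) \<in> foldl (adjoin (polys Z)) I as"
      unfolding polys.foldl_adjoin_eq[OF I] using g polys.ideal_zero[OF I]
      by (auto intro!: exI[of _ 0] exI[of _ g])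
    ultimately show "x \<in> (\<lambda>p. I +>\<^bsub>mpoly_ring Z\<^esub> p) ` foldl (adjoin (polys Z)) I as" by blast
  next
    fix x assume "x \<in> (\<lambda>p. I +>\<^bsub>mpoly_ring Z\<^esub> p) ` foldl (adjoin (polys Z)) I as"
    then obtain p g where pg: "p \<in> I" "\<And>j. j < length as \<Longrightarrow> g j \<in> polys Z"
      "x = I +>\<^bsub>mpoly_ring Z\<^esub> (p + (\<Sum>j<length as. as ! j * g j))"
      unfolding polys.foldl_adjoin_eq[OF I] by blast
    have "x = I +>\<^bsub>mpoly_ring Z\<^esub> (\<Sum>j<length as. as ! j * g j)"
      unfolding pg(3) using pg(1) by (subst coset_eq_iff) simp
    also have "\<dots> = (\<Oplus>\<^bsub>?M\<^esub>j\<in>{..<length as}. (as ! j) \<odot>\<^bsub>?M\<^esub> (I +>\<^bsub>mpoly_ring Z\<^esub> g j))"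
      using pg as by (intro quot_module_finsum[symmetric]) (auto simp: quot_module_smult)
    finally show "x \<in> seq_smult ?M as"
      using pg(2) unfolding seq_smult_def
      by (auto simp: carrier_quot_module intro!: exI[of _ "\<lambda>j. I +>\<^bsub>mpoly_ring Z\<^esub> g j"])
  qed
qed

lemma coset_in_image_iff:
  assumes "ideal_in (polys Z) B" "I \<subseteq> B"
  shows "I +>\<^bsub>mpoly_ring Z\<^esub> p \<in> (\<lambda>p. I +>\<^bsub>mpoly_ring Z\<^esub> p) ` B \<longleftrightarrow> p \<in> B"
  using assms polys.ideal_cong[OF assms(1)] by (auto simp: coset_eq_iff)

lemma subset_foldl_adjoin: "I \<subseteq> foldl (adjoin (polys Z)) I as"
  unfolding polys.foldl_adjoin_eq[OF I] by (auto intro!: exI[of _ "\<lambda>_. 0"])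

text \<open>The submodule \<open>(a_1,...,a_s)M\<close> of \<open>M = R/I\<close> is the image of
  \<open>I + (a_1,...,a_s)\<close>. As this ideal contains \<open>I\<close>, conditions on cosets
  become conditions on representatives.\<close>

lemma regular_seq_quot_module_iff:
  "regular_seq (mpoly_ring Z) (quot_module (mpoly_ring Z) I) as \<longleftrightarrow>
    set as \<subseteq> polys Z \<and> weakly_regular (polys Z) I as \<and> foldl (adjoin (polys Z)) I as \<noteq> polys Z"
proof (cases "set as \<subseteq> polys Z")
  case True
  let ?M = "quot_module (mpoly_ring Z) I" and ?B = "\<lambda>as. foldl (adjoin (polys Z)) I as"
  have B: "ideal_in (polys Z) (?B bs)" if "set bs \<subseteq> polys Z" for bs
    by (rule polys.ideal_in_foldl_adjoin[OF I that])
  have "(\<forall>x\<in>carrier ?M. (as ! i) \<odot>\<^bsub>?M\<^esub> x \<in> seq_smult ?M (take i as) \<longrightarrow> x \<in> seq_smult ?M (take i as))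
      \<longleftrightarrow> nzd_mod (polys Z) (?B (take i as)) (as ! i)" if i: "i < length as" for i
  proof -
    have sub: "set (take i as) \<subseteq> polys Z" "as ! i \<in> polys Z"
      using True i by (auto dest: in_set_takeD)
    show ?thesis
      unfolding nzd_mod_def carrier_quot_module seq_smult_quot_module[OF sub(1)] Ball_image_comp comp_def
      using sub(2)
      by (intro ball_cong refl)
         (simp add: quot_module_smult coset_in_image_iff[OF B[OF sub(1)] subset_foldl_adjoin])
  qed
  moreover have "seq_smult ?M as = carrier ?M \<longleftrightarrow> ?B as = polys Z"
    unfolding carrier_quot_module seq_smult_quot_module[OF True]
  proof
    assume eq: "(\<lambda>p. I +>\<^bsub>mpoly_ring Z\<^esub> p) ` ?B as = (\<lambda>p. I +>\<^bsub>mpoly_ring Z\<^esub> p) ` polys Z"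
    have "p \<in> ?B as" if "p \<in> polys Z" for p
      using that unfolding coset_in_image_iff[OF B[OF True] subset_foldl_adjoin, symmetric] eq
      by (rule imageI)
    then show "?B as = polys Z" using polys.ideal_subset[OF B[OF True]] by blast
  qed simp
  ultimately show ?thesis
    using True unfolding regular_seq_def weakly_regular_iff_nth by auto
qed (simp add: regular_seq_def)

end

lemma upward_closed_nonzero: "upward_closed Z (- {0})"
  by (auto simp: upward_closed_def poly_mapping_eq_iff fun_eq_iff plus_poly_mapping.rep_eq)

lemma zero_notin_deficit_set: "n \<ge> 2 \<Longrightarrow> t \<ge> 1 \<Longrightarrow> 0 \<notin> deficit_set n t (\<lambda>_. t)"
  by (simp add: deficit_set_def)

lemma depth_quot_deficit:
  fixes I :: "'k::field mpoly set"
  assumes n: "n \<ge> 2" and t: "t \<ge> 1"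
    and I_def: "I = monomial_ideal {1..n} (deficit_set n t (\<lambda>_. t))"
  shows "depth (mpoly_ring {1..n}) (graded_max_ideal n) (quot_module (mpoly_ring {1..n}) I) = n - 1 - t"
proof -
  let ?C = "polys {1..n} :: 'k mpoly set"
  let ?L = "{length as | as. set as \<subseteq> graded_max_ideal n \<and>
    regular_seq (mpoly_ring {1..n}) (quot_module (mpoly_ring {1..n}) I) as}"
  have I: "ideal_in ?C I" unfolding I_def by (rule ideal_in_monomial_ideal[OF upward_closed_deficit_set])
  obtain e where e: "Poly_Mapping.keys e \<subseteq> {1..n}"
    "\<And>T. T \<subseteq> {1..n} \<Longrightarrow> e + indicator_exp T \<in> deficit_set n t (\<lambda>_. t) \<longleftrightarrow> n - 1 - t < card T"
    using deficit_set_witness[OF n t] by blast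
  have nonzero: "polys.koszul_nonzero {1..n} n pvar (n - 1 - t) I"
    unfolding I_def using n
    by (intro koszul_nonzero_monomial_ideal[OF upward_closed_deficit_set _ e]) linarith
  have upper: "l \<le> n - 1 - t" if l: "l \<in> ?L" for l
  proof -
    obtain as where as: "l = length as" "set as \<subseteq> graded_max_ideal n" "weakly_regular ?C I as"
      using l unfolding regular_seq_quot_module_iff[OF I] by blast
    show ?thesis
      unfolding as(1)
    proof (rule polys.weakly_regular_length_le[OF I _ nonzero as(3)])
      show "\<exists>y. (\<forall>i\<in>{1..n}. y i \<in> ?C) \<and> a = (\<Sum>i\<in>{1..n}. y i * pvar i)" if "a \<in> set as" for a
        using graded_max_ideal_span as(2) that by blast
    qed simp
  qed
  let ?es = "esyms n (n - 1 - t) :: 'k mpoly list"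
  have es: "set ?es \<subseteq> graded_max_ideal n" using esym_in_graded_max_ideal by (auto simp del: upt_Suc)
  have esC: "set ?es \<subseteq> ?C" using esym_in_polys unfolding set_map by blast
  have wr: "weakly_regular ?C I ?es" unfolding I_def by (rule weakly_regular_esyms_deficit)
  have "foldl (adjoin ?C) I ?es \<noteq> ?C"
  proof
    assume "foldl (adjoin ?C) I ?es = ?C"
    then have "1 \<in> foldl (adjoin ?C) I ?es" by simp
    then obtain p y where py: "p \<in> I" "\<forall>j<length ?es. y j \<in> ?C" "1 = p + (\<Sum>j<length ?es. ?es ! j * y j)"
      unfolding polys.foldl_adjoin_eq[OF I] by blast
    \<comment> \<open>\<open>N\<close> is the maximal ideal in monomial form; it contains
      \<open>I\<close> and the symmetric polynomials but not \<open>1\<close>.\<close>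
    define N where "N = (monomial_ideal {1..n} (- {0}) :: 'k mpoly set)"
    have N: "ideal_in ?C N"
      unfolding N_def by (rule ideal_in_monomial_ideal[OF upward_closed_nonzero])
    have "p \<in> N"
      using py(1) zero_notin_deficit_set[OF n t] by (auto simp: I_def N_def monomial_ideal_def)
    moreover have "?es ! j * y j \<in> N" if j: "j < length ?es" for j
    proof (rule polys.ideal_mult'[OF N])
      have "?es ! j \<in> set ?es" using j by (rule nth_mem)
      then have "?es ! j \<in> ?C" "Poly_Mapping.lookup (?es ! j) 0 = 0"
        using es esC graded_max_ideal_lookup_0 by blast+
      then show "?es ! j \<in> N"
        unfolding N_def monomial_ideal_def by (auto simp: in_keys_iff)
      show "y j \<in> ?C" using py(2) j by blast
    qed
    ultimately have "1 \<in> N"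
      unfolding py(3) by (intro polys.ideal_add[OF N] polys.ideal_sum[OF N]) simp_all
    then show False by (simp add: N_def monomial_ideal_def)
  qed
  then have reg: "regular_seq (mpoly_ring {1..n}) (quot_module (mpoly_ring {1..n}) I) ?es"
    using wr esC
    unfolding regular_seq_quot_module_iff[OF I] by blast
  have len: "n - 1 - t = length ?es" by (simp del: upt_Suc)
  have "n - 1 - t \<in> ?L" by (intro CollectI exI[of _ ?es] conjI len reg es)
  \<comment> \<open>\<open>Max\<close> is meaningful only on a finite set, so the bound also has to
    supply finiteness.\<close>
  moreover have "finite ?L" using upper by (meson finite_nat_set_iff_bounded_le)
  ultimately show ?thesis
    unfolding depth_def using upper by (intro Max_eqI) auto
qed

section \<open>Stanley decompositions\<close>

definition exp_cell :: "(nat \<Rightarrow>\<^sub>0 nat) \<Rightarrow> nat set \<Rightarrow> (nat \<Rightarrow>\<^sub>0 nat) set" where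
  "exp_cell a Z = {a + f | f. Poly_Mapping.keys f \<subseteq> Z}"

lemma keys_monom_mult_in_cell:
  fixes u :: "'k::field mpoly"
  assumes "u \<in> polys Z" shows "Poly_Mapping.keys (u * monom a) \<subseteq> exp_cell a Z"
proof -
  have "Poly_Mapping.keys (monom a * u) = (+) a ` Poly_Mapping.keys u" by (simp add: keys_single_mult)
  then show ?thesis using assms by (auto simp: exp_cell_def in_polys_iff mult.commute[of u])
qed

text \<open>The part of \<open>p\<close> in a cell lies in \<open>x^a K[Z]\<close>; it will be the
  component of \<open>p\<close> in that summand.\<close>

lemma restrict_keys_cell:
  fixes p :: "'k::field mpoly"
  obtains u where "u \<in> polys Z" "u * monom a = restrict_keys (exp_cell a Z) p"
proof
  let ?K = "Poly_Mapping.keys p \<inter> exp_cell a Z"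
  let ?u = "\<Sum>e\<in>?K. Poly_Mapping.single (e - a) (Poly_Mapping.lookup p e)"
  show "?u \<in> polys Z"
    by (intro polys.sum_closed single_in_polys) (auto simp: exp_cell_def)
  have "?u * monom a = (\<Sum>e\<in>?K. Poly_Mapping.single e (Poly_Mapping.lookup p e))"
    unfolding sum_distrib_right by (rule sum.cong) (auto simp: exp_cell_def mult_single add.commute)
  also have "\<dots> = restrict_keys (exp_cell a Z) p"
    by (subst (2) poly_eq_sum_single) (simp add: keys_restrict lookup_restrict when_def)
  finally show "?u * monom a = restrict_keys (exp_cell a Z) p" .
qed

context
  fixes n :: nat and U :: "(nat \<Rightarrow>\<^sub>0 nat) set" and I :: "'k::field mpoly set"
  assumes U: "upward_closed {1..n} U" and I_def: "I = monomial_ideal {1..n} U"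
begin

private abbreviation "cls p \<equiv> I +>\<^bsub>mpoly_ring {1..n}\<^esub> p"
private abbreviation "M \<equiv> quot_module (mpoly_ring {1..n}) I"

lemma ideal_in_I: "ideal_in (polys {1..n}) I"
  unfolding I_def by (rule ideal_in_monomial_ideal[OF U])

text \<open>The monomials outside \<open>U\<close> represent a \<open>K\<close>-basis of
  \<open>S/I\<close>, so splitting them into disjoint cells splits the module, and a cell that
  avoids \<open>U\<close> gives a free summand.\<close>

lemma stanley_decomposition_cells:
  fixes a :: "nat \<Rightarrow> nat \<Rightarrow>\<^sub>0 nat" and Z :: "nat \<Rightarrow> nat set"
  assumes a: "\<And>i. i \<in> {1..r} \<Longrightarrow> Poly_Mapping.keys (a i) \<subseteq> {1..n}"
    and Z: "\<And>i. i \<in> {1..r} \<Longrightarrow> Z i \<subseteq> {1..n}"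
    and avoid: "\<And>i. i \<in> {1..r} \<Longrightarrow> exp_cell (a i) (Z i) \<inter> U = {}"
    and cover: "\<And>e. Poly_Mapping.keys e \<subseteq> {1..n} \<Longrightarrow> e \<notin> U \<Longrightarrow> \<exists>i\<in>{1..r}. e \<in> exp_cell (a i) (Z i)"
    and disjoint: "\<And>i k. i \<in> {1..r} \<Longrightarrow> k \<in> {1..r} \<Longrightarrow> i \<noteq> k \<Longrightarrow>
      exp_cell (a i) (Z i) \<inter> exp_cell (a k) (Z k) = {}"
  shows "stanley_decomposition n M (quot_component n I) r (\<lambda>i. cls (monom (a i))) Z"
proof -
  note I = ideal_in_I
  have mon: "monom (a i) \<in> polys {1..n}" if "i \<in> {1..r}" for i
    using a that by (simp add: single_in_polys)
  have sub: "u \<in> polys {1..n}" if "i \<in> {1..r}" "u \<in> polys (Z i)" for i and u :: "'k mpoly"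
    using polys_mono[OF Z] that by blast
  have carr: "cls (monom (a i)) \<in> carrier M" if "i \<in> {1..r}" for i
    unfolding carrier_quot_module[OF I] using mon[OF that] by (rule imageI)
  have degree: "\<exists>b\<in>multidegrees n. cls (monom (a i)) \<in> quot_component n I b" if i: "i \<in> {1..r}" for i
  proof
    let ?b = "\<lambda>k\<in>{1..n}. int (Poly_Mapping.lookup (a i) k)"
    show "?b \<in> multidegrees n" by (simp add: multidegrees_def)
    show "cls (monom (a i)) \<in> quot_component n I ?b"
      using mon[OF i] unfolding quot_component_def poly_component_def by (intro imageI CollectI) simp
  qed
  have inj: "inj_on (\<lambda>u. u \<odot>\<^bsub>M\<^esub> cls (monom (a i))) (polys (Z i))" if i: "i \<in> {1..r}" for i
  proof (rule inj_onI)
    fix u v :: "'k mpoly" assume uv: "u \<in> polys (Z i)" "v \<in> polys (Z i)"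
      and eq: "u \<odot>\<^bsub>M\<^esub> cls (monom (a i)) = v \<odot>\<^bsub>M\<^esub> cls (monom (a i))"
    have "(u - v) * monom (a i) \<in> I"
      using eq
      unfolding quot_module_smult[OF I sub[OF i uv(1)] mon[OF i]]
        quot_module_smult[OF I sub[OF i uv(2)] mon[OF i]] coset_eq_iff[OF I] left_diff_distrib .
    then have "Poly_Mapping.keys ((u - v) * monom (a i)) \<subseteq> U" by (simp add: I_def monomial_ideal_def)
    moreover have "Poly_Mapping.keys ((u - v) * monom (a i)) \<subseteq> exp_cell (a i) (Z i)"
      using uv by (intro keys_monom_mult_in_cell) auto
    ultimately have "Poly_Mapping.keys ((u - v) * monom (a i)) = {}"
      using avoid[OF i] by blast
    then have "Poly_Mapping.keys (monom (a i) * (u - v)) = {}" by (simp only: mult.commute)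
    then have "Poly_Mapping.keys (u - v) = {}"
      by (simp only: keys_single_mult[OF one_neq_zero] image_is_empty)
    then show "u = v" by simp
  qed
  have unique: "\<exists>!y. y \<in> (\<Pi>\<^sub>E i\<in>{1..r}. stanley_space M (cls (monom (a i))) (Z i)) \<and>
      x = (\<Oplus>\<^bsub>M\<^esub>i\<in>{1..r}. y i)" if x: "x \<in> carrier M" for x
  proof -
    obtain p where p: "x = cls p" "p \<in> polys {1..n}"
      using x[unfolded carrier_quot_module[OF I]] by (rule imageE)
    have "\<exists>u\<in>polys (Z i). u * monom (a i) = restrict_keys (exp_cell (a i) (Z i)) p" for i
      by (rule restrict_keys_cell[of "Z i" "a i" p]) blast
    then obtain u where u: "\<And>i. u i \<in> polys (Z i)"
      "\<And>i. u i * monom (a i) = restrict_keys (exp_cell (a i) (Z i)) p" by metis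
    let ?y = "\<lambda>i\<in>{1..r}. cls (u i * monom (a i))"
    have y: "?y \<in> (\<Pi>\<^sub>E i\<in>{1..r}. stanley_space M (cls (monom (a i))) (Z i))"
    proof (rule restrict_PiE_iff[THEN iffD2], rule ballI)
      fix i assume i: "i \<in> {1..r}"
      have "cls (u i * monom (a i)) = u i \<odot>\<^bsub>M\<^esub> cls (monom (a i))"
        by (rule quot_module_smult[OF I sub[OF i u(1)] mon[OF i], symmetric])
      then show "cls (u i * monom (a i)) \<in> stanley_space M (cls (monom (a i))) (Z i)"
        unfolding stanley_space_def using u(1) by blast
    qed
    have "(\<Oplus>\<^bsub>M\<^esub>i\<in>{1..r}. ?y i) = cls (\<Sum>i\<in>{1..r}. u i * monom (a i))"
      using sub u(1) mon by (intro quot_module_finsum[OF I] polys.mult_closed) simp_all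
    also have "\<dots> = cls p"
    proof -
      \<comment> \<open>Outside \<open>U\<close> a monomial of \<open>p\<close> lies in exactly one
        cell, so the pieces add up to its coefficient.\<close>
      have "e \<in> U" if e: "e \<in> Poly_Mapping.keys ((\<Sum>i\<in>{1..r}. u i * monom (a i)) - p)" for e
      proof (rule ccontr)
        assume "e \<notin> U"
        have "Poly_Mapping.lookup (\<Sum>i\<in>{1..r}. u i * monom (a i)) e = Poly_Mapping.lookup p e"
        proof (cases "e \<in> Poly_Mapping.keys p")
          case True
          then have "Poly_Mapping.keys e \<subseteq> {1..n}" using p(2) unfolding in_polys_iff by blast
          from cover[OF this \<open>e \<notin> U\<close>] obtain k where k: "k \<in> {1..r}" "e \<in> exp_cell (a k) (Z k)" by blast
          have "(\<Sum>i\<in>{1..r}. Poly_Mapping.lookup (u i * monom (a i)) e) =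
              (\<Sum>i\<in>{1..r}. if i = k then Poly_Mapping.lookup p e else 0)"
            using disjoint k by (intro sum.cong) (auto simp: u(2) lookup_restrict when_def)
          then show ?thesis using k by (simp add: lookup_sum)
        next
          case False
          then show ?thesis by (simp add: lookup_sum u(2) lookup_restrict in_keys_iff)
        qed
        with e show False by (simp add: in_keys_iff lookup_minus)
      qed
      moreover have "(\<Sum>i\<in>{1..r}. u i * monom (a i)) - p \<in> polys {1..n}"
        using sub u(1) mon p by (intro polys.diff_closed polys.sum_closed polys.mult_closed) auto
      ultimately have "(\<Sum>i\<in>{1..r}. u i * monom (a i)) - p \<in> I"
        by (auto simp: I_def monomial_ideal_def)
      then show ?thesis unfolding coset_eq_iff[OF I] .
    qed
    finally have exist: "x = (\<Oplus>\<^bsub>M\<^esub>i\<in>{1..r}. ?y i)" by (simp only: p(1))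
    have "y = z" if yz: "y \<in> (\<Pi>\<^sub>E i\<in>{1..r}. stanley_space M (cls (monom (a i))) (Z i))"
        "z \<in> (\<Pi>\<^sub>E i\<in>{1..r}. stanley_space M (cls (monom (a i))) (Z i))"
        "(\<Oplus>\<^bsub>M\<^esub>i\<in>{1..r}. y i) = (\<Oplus>\<^bsub>M\<^esub>i\<in>{1..r}. z i)" for y z
    proof -
      have rep: "\<exists>v. \<forall>i\<in>{1..r}. v i \<in> polys (Z i) \<and> y i = cls (v i * monom (a i))"
        if "y \<in> (\<Pi>\<^sub>E i\<in>{1..r}. stanley_space M (cls (monom (a i))) (Z i))" for y
      proof (rule bchoice, rule ballI)
        fix i assume i: "i \<in> {1..r}"
        then have "y i \<in> stanley_space M (cls (monom (a i))) (Z i)" using that by blast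
        then obtain v where "v \<in> polys (Z i)" "y i = v \<odot>\<^bsub>M\<^esub> cls (monom (a i))"
          unfolding stanley_space_def by blast
        then show "\<exists>v. v \<in> polys (Z i) \<and> y i = cls (v * monom (a i))"
          using sub[OF i] mon[OF i] by (metis quot_module_smult[OF I])
      qed
      obtain v w where vw: "\<And>i. i \<in> {1..r} \<Longrightarrow> v i \<in> polys (Z i)"
        "\<And>i. i \<in> {1..r} \<Longrightarrow> w i \<in> polys (Z i)"
        "\<And>i. i \<in> {1..r} \<Longrightarrow> y i = cls (v i * monom (a i))"
        "\<And>i. i \<in> {1..r} \<Longrightarrow> z i = cls (w i * monom (a i))"
        using rep[OF yz(1)] rep[OF yz(2)] by metis
      have vC: "v i * monom (a i) \<in> polys {1..n}" and wC: "w i * monom (a i) \<in> polys {1..n}"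
        if i: "i \<in> {1..r}" for i
        by (rule polys.mult_closed[OF sub[OF i vw(1)[OF i]] mon[OF i]],
            rule polys.mult_closed[OF sub[OF i vw(2)[OF i]] mon[OF i]])
      define d where "d i = (v i - w i) * monom (a i)" for i
      have d: "Poly_Mapping.keys (d i) \<subseteq> exp_cell (a i) (Z i)" if "i \<in> {1..r}" for i
        unfolding d_def using vw that by (intro keys_monom_mult_in_cell) auto
      have "cls (\<Sum>i\<in>{1..r}. v i * monom (a i)) = (\<Oplus>\<^bsub>M\<^esub>i\<in>{1..r}. y i)"
        by (rule quot_module_finsum[OF I, symmetric]) (simp_all only: vw(3) vC finite_atLeastAtMost)
      also have "\<dots> = cls (\<Sum>i\<in>{1..r}. w i * monom (a i))"
        unfolding yz(3)
        by (rule quot_module_finsum[OF I]) (simp_all only: vw(4) wC finite_atLeastAtMost)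
      finally have "(\<Sum>i\<in>{1..r}. d i) \<in> I"
        by (simp only: coset_eq_iff[OF I] d_def left_diff_distrib sum_subtractf)
      then have sum_d: "Poly_Mapping.keys (\<Sum>i\<in>{1..r}. d i) \<subseteq> U" by (simp add: I_def monomial_ideal_def)
      \<comment> \<open>At an exponent of cell \<open>k\<close> no other difference has a nonzero
        coefficient, so nothing cancels there and the exponent would lie in \<open>U\<close>, which
        the cell avoids.\<close>
      have "d k = 0" if k: "k \<in> {1..r}" for k
      proof -
        have "e \<notin> Poly_Mapping.keys (d k)" for e
        proof
          assume e: "e \<in> Poly_Mapping.keys (d k)"
          then have ek: "e \<in> exp_cell (a k) (Z k)" using d[OF k] by blast
          have "Poly_Mapping.lookup (d i) e = 0" if "i \<in> {1..r} - {k}" for i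
            using d[of i] disjoint[of i k] k ek that by (auto simp flip: not_in_keys_iff_lookup_eq_zero)
          then have "Poly_Mapping.lookup (\<Sum>i\<in>{1..r}. d i) e = Poly_Mapping.lookup (d k) e"
            unfolding lookup_sum by (subst sum.remove[OF _ k]) auto
          then have "e \<in> U" using e sum_d by (auto simp: in_keys_iff)
          with avoid[OF k] ek show False by blast
        qed
        then show ?thesis by (metis all_not_in_conv keys_eq_empty)
      qed
      then have "v i * monom (a i) = w i * monom (a i)" if "i \<in> {1..r}" for i
        using that unfolding d_def left_diff_distrib right_minus_eq by blast
      then have "y i = z i" if "i \<in> {1..r}" for i
        using vw(3,4)[OF that] that by metis
      then show ?thesis using PiE_ext[OF yz(1,2)] by blast
    qed
    note uniq = this
    show ?thesis
    proof (rule ex1I[of _ ?y], rule conjI[OF y exist])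
      fix z assume z: "z \<in> (\<Pi>\<^sub>E i\<in>{1..r}. stanley_space M (cls (monom (a i))) (Z i)) \<and>
        x = (\<Oplus>\<^bsub>M\<^esub>i\<in>{1..r}. z i)"
      show "z = ?y"
        by (rule uniq[OF conjunct1[OF z] y trans[OF conjunct2[OF z, symmetric] exist]])
    qed
  qed
  show ?thesis
    unfolding stanley_decomposition_def by (intro conjI ballI carr degree Z inj unique)
qed

text \<open>Homogeneity makes each \<open>m i\<close> the class of a scalar multiple of one
  monomial. Some summand reaches \<open>x^w\<close>, by \<open>x^f\<close> times \<open>m i\<close>
  up to a scalar; a variable of \<open>B\<close> in \<open>Z i\<close> would push this into
  \<open>I\<close>, against freeness.\<close>

lemma stanley_decomposition_bound:
  assumes dec: "stanley_decomposition n M (quot_component n I) r m Z"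
    and w: "Poly_Mapping.keys w \<subseteq> {1..n}" "w \<notin> U"
    and B: "\<And>k. k \<in> B \<Longrightarrow> k \<in> {1..n} \<and> Poly_Mapping.single k 1 + w \<in> U"
  shows "\<exists>i\<in>{1..r}. Z i \<subseteq> {1..n} - B"
proof -
  note I = ideal_in_I
  let ?G = "quot_component n I"
  have m: "m i \<in> carrier M" "\<exists>b\<in>multidegrees n. m i \<in> ?G b" "Z i \<subseteq> {1..n}"
    "inj_on (\<lambda>u. u \<odot>\<^bsub>M\<^esub> m i) (polys (Z i))" if "i \<in> {1..r}" for i
    using dec that unfolding stanley_decomposition_def by blast+
  have "\<forall>i\<in>{1..r}. \<exists>q. q \<in> polys {1..n} \<and> m i = cls q \<and> (\<exists>e. Poly_Mapping.keys q \<subseteq> {e})"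
  proof
    fix i assume i: "i \<in> {1..r}"
    then obtain b q where q: "m i = cls q" "q \<in> poly_component n b"
      using m(2) unfolding quot_component_def by blast
    \<comment> \<open>The degree fixes the exponents in \<open>{1..n}\<close> and all others are
      zero, so a homogeneous polynomial has at most one monomial.\<close>
    have "e = e'" if "e \<in> Poly_Mapping.keys q" "e' \<in> Poly_Mapping.keys q" for e e'
    proof (rule poly_mapping_eqI)
      fix k
      have keys: "Poly_Mapping.keys e \<subseteq> {1..n}" "Poly_Mapping.keys e' \<subseteq> {1..n}"
        using that q(2) by (auto simp: poly_component_def in_polys_iff)
      show "Poly_Mapping.lookup e k = Poly_Mapping.lookup e' k"
      proof (cases "k \<in> {1..n}")
        case True
        then have "int (Poly_Mapping.lookup e k) = b k" "int (Poly_Mapping.lookup e' k) = b k"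
          using that q(2) unfolding poly_component_def by blast+
        then show ?thesis by simp
      next
        case False
        then show ?thesis using keys by (metis in_keys_iff subsetD)
      qed
    qed
    then have "\<exists>e. Poly_Mapping.keys q \<subseteq> {e}" by blast
    with q show "\<exists>q. q \<in> polys {1..n} \<and> m i = cls q \<and> (\<exists>e. Poly_Mapping.keys q \<subseteq> {e})"
      unfolding poly_component_def by blast
  qed
  then obtain q where q: "\<And>i. i \<in> {1..r} \<Longrightarrow> q i \<in> polys {1..n}"
    "\<And>i. i \<in> {1..r} \<Longrightarrow> m i = cls (q i)"
    "\<And>i. i \<in> {1..r} \<Longrightarrow> \<exists>e. Poly_Mapping.keys (q i) \<subseteq> {e}"
    using bchoice[of "{1..r}"] by metis
  have "cls (monom w) \<in> carrier M"
    using w(1) unfolding carrier_quot_module[OF I] by (intro imageI single_in_polys)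
  with dec have "\<exists>!y. y \<in> (\<Pi>\<^sub>E i\<in>{1..r}. stanley_space M (m i) (Z i)) \<and>
      cls (monom w) = (\<Oplus>\<^bsub>M\<^esub>i\<in>{1..r}. y i)"
    unfolding stanley_decomposition_def by (elim conjE) (rule bspec)
  then obtain y where y: "y \<in> (\<Pi>\<^sub>E i\<in>{1..r}. stanley_space M (m i) (Z i))"
    "cls (monom w) = (\<Oplus>\<^bsub>M\<^esub>i\<in>{1..r}. y i)"
    by (elim ex1E conjE)
  have "\<forall>i\<in>{1..r}. \<exists>u. u \<in> polys (Z i) \<and> y i = u \<odot>\<^bsub>M\<^esub> m i"
    using y(1) unfolding stanley_space_def by blast
  then obtain u where u: "\<And>i. i \<in> {1..r} \<Longrightarrow> u i \<in> polys (Z i)"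
    "\<And>i. i \<in> {1..r} \<Longrightarrow> y i = u i \<odot>\<^bsub>M\<^esub> m i"
    using bchoice[of "{1..r}"] by metis
  have uC: "u i \<in> polys {1..n}" if "i \<in> {1..r}" for i
    using polys_mono[OF m(3) u(1)] that by blast
  have smult: "v \<odot>\<^bsub>M\<^esub> m i = cls (v * q i)" if "i \<in> {1..r}" "v \<in> polys {1..n}" for i v
    using that q by (simp only: quot_module_smult[OF I])
  have "cls (monom w) = cls (\<Sum>i\<in>{1..r}. u i * q i)"
    unfolding y(2)
    by (rule quot_module_finsum[OF I]) (simp_all only: u(2) smult uC q(1) polys.mult_closed finite_atLeastAtMost)
  then have "monom w - (\<Sum>i\<in>{1..r}. u i * q i) \<in> I" by (simp only: coset_eq_iff[OF I])
  then have "w \<notin> Poly_Mapping.keys (monom w - (\<Sum>i\<in>{1..r}. u i * q i))"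
    using w(2) unfolding I_def monomial_ideal_def by blast
  \<comment> \<open>As \<open>w\<close> is outside \<open>U\<close>, its coefficient is determined
    modulo \<open>I\<close>, and some summand has to contribute to it.\<close>
  then have "(\<Sum>i\<in>{1..r}. Poly_Mapping.lookup (u i * q i) w) = 1"
    by (simp add: in_keys_iff lookup_minus lookup_sum)
  then obtain i where i: "i \<in> {1..r}" "Poly_Mapping.lookup (u i * q i) w \<noteq> 0"
    by (metis (no_types, lifting) sum.neutral zero_neq_one)
  then have "w \<in> Poly_Mapping.keys (u i * q i)" by (simp add: in_keys_iff)
  then obtain f e where fe: "w = f + e" "f \<in> Poly_Mapping.keys (u i)" "e \<in> Poly_Mapping.keys (q i)"
    using keys_mult[of "u i" "q i"] by blast
  have qe: "Poly_Mapping.keys (q i) \<subseteq> {e}" using q(3)[OF i(1)] fe(3) by blast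
  have "k \<notin> B" if k: "k \<in> Z i" for k
  proof
    assume kB: "k \<in> B"
    \<comment> \<open>This monomial \<open>x_k x^f\<close> lies in \<open>K[Z i]\<close> and
      multiplies \<open>m i\<close> to zero.\<close>
    let ?v = "monom (Poly_Mapping.single k 1 + f) :: 'k mpoly"
    have keys_v: "Poly_Mapping.keys (Poly_Mapping.single k 1 + f) \<subseteq> Z i"
      using k fe(2) u(1)[OF i(1)] by (auto simp: keys_exp_add in_polys_iff)
    have vZ: "?v \<in> polys (Z i)" by (rule single_in_polys[OF keys_v])
    have vC: "?v \<in> polys {1..n}" using polys_mono[OF m(3)[OF i(1)] vZ] .
    have "Poly_Mapping.keys (?v * q i) \<subseteq> {Poly_Mapping.single k 1 + w}"
      using qe by (auto simp: keys_single_mult fe(1) add.assoc)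
    then have "?v * q i \<in> I"
      using B[OF kB] vC q(1)[OF i(1)] polys.mult_closed unfolding I_def monomial_ideal_def by blast
    then have "?v \<odot>\<^bsub>M\<^esub> m i = 0 \<odot>\<^bsub>M\<^esub> m i"
      using smult[OF i(1) vC] smult[OF i(1) polys.zero_closed] by (simp only: coset_eq_iff[OF I]) simp
    then have "?v = 0"
      using m(4)[OF i(1)] vZ polys.zero_closed unfolding inj_on_def by blast
    then have "Poly_Mapping.lookup ?v (Poly_Mapping.single k 1 + f) = 0" by (simp only: lookup_zero)
    then show False by (simp only: lookup_single_eq one_neq_zero)
  qed
  then show ?thesis using i(1) m(3)[OF i(1)] by blast
qed

end

section \<open>The cells of the left-to-right decomposition\<close>

definition partial_deficit :: "nat \<Rightarrow> (nat \<Rightarrow>\<^sub>0 nat) \<Rightarrow> nat \<Rightarrow> nat" where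
  "partial_deficit t e k = (\<Sum>i\<in>{1..k}. t - Poly_Mapping.lookup e i)"

text \<open>Reading the exponents of \<open>e\<close> from left to right, \<open>cell_start n t e\<close> cuts them at \<open>t\<close> as long
  as the sum of the deficits read so far is at most \<open>t\<close>, and forgets all later ones. The variables
  in \<open>free_vars n t\<close> are those that were cut or forgotten; each of the others increases the sum.\<close>

definition cell_start :: "nat \<Rightarrow> nat \<Rightarrow> (nat \<Rightarrow>\<^sub>0 nat) \<Rightarrow> nat \<Rightarrow>\<^sub>0 nat" where
  "cell_start n t e = (\<Sum>i\<in>{1..n}. Poly_Mapping.single i
     (if partial_deficit t e (i - 1) \<le> t then min (Poly_Mapping.lookup e i) t else 0))"

definition free_vars :: "nat \<Rightarrow> nat \<Rightarrow> (nat \<Rightarrow>\<^sub>0 nat) \<Rightarrow> nat set" where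
  "free_vars n t a = {i\<in>{1..n}. partial_deficit t a (i - 1) \<le> t \<longrightarrow> t \<le> Poly_Mapping.lookup a i}"

lemma partial_deficit_Suc:
  "partial_deficit t e (Suc k) = partial_deficit t e k + (t - Poly_Mapping.lookup e (Suc k))"
  by (simp add: partial_deficit_def)

lemma deficit_set_iff: "e \<in> deficit_set n t (\<lambda>_. t) \<longleftrightarrow> partial_deficit t e n \<le> t"
  by (simp add: deficit_set_def partial_deficit_def)

text \<open>Agreement is asked only until the sum for \<open>e\<close> passes \<open>t\<close>; from
  then on both sums exceed \<open>t\<close> for good, since they never decrease.\<close>

lemma partial_deficit_cong:
  assumes "\<And>i. i \<in> {1..k} \<Longrightarrow> partial_deficit t e (i - 1) \<le> t \<Longrightarrow>
    t - Poly_Mapping.lookup e i = t - Poly_Mapping.lookup a i"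
  shows "(partial_deficit t a k \<le> t \<longleftrightarrow> partial_deficit t e k \<le> t) \<and>
    (partial_deficit t e k \<le> t \<longrightarrow> partial_deficit t a k = partial_deficit t e k)"
  using assms
proof (induction k)
  case 0
  show ?case by (simp add: partial_deficit_def)
next
  case (Suc k)
  have IH: "(partial_deficit t a k \<le> t \<longleftrightarrow> partial_deficit t e k \<le> t) \<and>
      (partial_deficit t e k \<le> t \<longrightarrow> partial_deficit t a k = partial_deficit t e k)"
    by (rule Suc.IH) (rule Suc.prems, auto)
  show ?case
  proof (cases "partial_deficit t e k \<le> t")
    case True
    then have "t - Poly_Mapping.lookup e (Suc k) = t - Poly_Mapping.lookup a (Suc k)"
      using Suc.prems[of "Suc k"] by simp
    with True IH show ?thesis by (simp add: partial_deficit_Suc)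
  next
    case False
    with IH show ?thesis by (simp add: partial_deficit_Suc)
  qed
qed

lemma lookup_cell_start:
  "Poly_Mapping.lookup (cell_start n t e) i = (if i \<in> {1..n} \<and> partial_deficit t e (i - 1) \<le> t
     then min (Poly_Mapping.lookup e i) t else 0)"
  by (simp add: cell_start_def lookup_sum lookup_single when_def)

lemma keys_cell_start: "Poly_Mapping.keys (cell_start n t e) \<subseteq> {1..n}"
  unfolding subset_iff in_keys_iff lookup_cell_start by presburger

text \<open>Cutting an exponent at \<open>t\<close> leaves its deficit unchanged, and exponents are
  forgotten only after the bound has been passed.\<close>

lemma partial_deficit_cell_start:
  assumes "k \<le> n"
  shows "partial_deficit t (cell_start n t e) k \<le> t \<longleftrightarrow> partial_deficit t e k \<le> t"
  using assms partial_deficit_cong[of k t e "cell_start n t e"] by (auto simp: lookup_cell_start)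

lemma mem_own_cell:
  assumes "Poly_Mapping.keys e \<subseteq> {1..n}"
  shows "e \<in> exp_cell (cell_start n t e) (free_vars n t (cell_start n t e))"
proof -
  let ?a = "cell_start n t e"
  have 0: "Poly_Mapping.lookup e i = 0" if "i \<notin> {1..n}" for i
    using assms that by (metis in_keys_iff subsetD)
  have "Poly_Mapping.lookup ?a i \<le> Poly_Mapping.lookup e i" for i
    by (simp add: lookup_cell_start)
  then have "e = ?a + (e - ?a)" by (rule exp_add_diff[symmetric])
  moreover have "Poly_Mapping.keys (e - ?a) \<subseteq> free_vars n t ?a"
  proof
    fix i assume "i \<in> Poly_Mapping.keys (e - ?a)"
    then have lt: "Poly_Mapping.lookup ?a i < Poly_Mapping.lookup e i"
      by (simp add: in_keys_iff lookup_minus)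
    then have i: "i \<in> {1..n}" using 0 by fastforce
    then have "partial_deficit t ?a (i - 1) \<le> t \<longleftrightarrow> partial_deficit t e (i - 1) \<le> t"
      by (intro partial_deficit_cell_start) auto
    then show "i \<in> free_vars n t ?a"
      using lt i by (auto simp: free_vars_def lookup_cell_start)
  qed
  ultimately show ?thesis unfolding exp_cell_def by blast
qed

text \<open>Moving in the free directions changes no deficit that is still being read, so the
  reading runs alike for all points of a cell. Hence distinct cells are disjoint, and each lies
  entirely inside or entirely outside the deficit set.\<close>

lemma cell_start_of_cell:
  assumes a: "a = cell_start n t e" and e': "e' \<in> exp_cell a (free_vars n t a)"
  shows "cell_start n t e' = a" and "partial_deficit t e' n \<le> t \<longleftrightarrow> partial_deficit t e n \<le> t"
proof -
  obtain f where f: "e' = a + f" "Poly_Mapping.keys f \<subseteq> free_vars n t a"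
    using e' by (auto simp: exp_cell_def)
  have le_t: "Poly_Mapping.lookup a i \<le> t" for i by (simp add: a lookup_cell_start)
  have dich: "Poly_Mapping.lookup a i = t \<or> Poly_Mapping.lookup e' i = Poly_Mapping.lookup a i"
    if "partial_deficit t a (i - 1) \<le> t" for i
  proof (cases "i \<in> Poly_Mapping.keys f")
    case True
    then have "t \<le> Poly_Mapping.lookup a i" using f(2) that by (auto simp: free_vars_def)
    with le_t[of i] show ?thesis by simp
  next
    case False
    then show ?thesis by (simp add: f(1) lookup_add in_keys_iff)
  qed
  have ge: "Poly_Mapping.lookup a i \<le> Poly_Mapping.lookup e' i" for i by (simp add: f(1) lookup_add)
  have pd: "partial_deficit t e' k \<le> t \<longleftrightarrow> partial_deficit t a k \<le> t" for k
  proof -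
    have "t - Poly_Mapping.lookup a i = t - Poly_Mapping.lookup e' i"
      if "partial_deficit t a (i - 1) \<le> t" for i
      using dich[OF that] ge[of i] by auto
    then show ?thesis using partial_deficit_cong[of k t a e'] by blast
  qed
  have pd_a: "partial_deficit t a k \<le> t \<longleftrightarrow> partial_deficit t e k \<le> t" if "k \<le> n" for k
    using partial_deficit_cell_start[OF that] a by simp
  show "partial_deficit t e' n \<le> t \<longleftrightarrow> partial_deficit t e n \<le> t"
    using pd[of n] pd_a[of n] by simp
  show "cell_start n t e' = a"
  proof (rule poly_mapping_eqI)
    fix i
    show "Poly_Mapping.lookup (cell_start n t e') i = Poly_Mapping.lookup a i"
    proof (cases "i \<in> {1..n} \<and> partial_deficit t e (i - 1) \<le> t")
      case True
      then have "partial_deficit t a (i - 1) \<le> t" using pd_a[of "i - 1"] by auto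
      then show ?thesis
        using True dich[of i] ge[of i] le_t[of i] pd[of "i - 1"] by (auto simp: lookup_cell_start)
    next
      case False
      have "\<not> (i \<in> {1..n} \<and> partial_deficit t e' (i - 1) \<le> t)"
      proof
        assume *: "i \<in> {1..n} \<and> partial_deficit t e' (i - 1) \<le> t"
        then have "i - 1 \<le> n" by auto
        with * show False using False pd[of "i - 1"] pd_a[of "i - 1"] by blast
      qed
      with False show ?thesis unfolding a lookup_cell_start by (simp only: if_False)
    qed
  qed
qed

text \<open>Each index that is not free adds at least one to the sum. Before the last of them the
  sum is still at most \<open>t\<close>, so there are at most \<open>t\<close> others; the last one
  may overshoot, which makes \<open>t + 1\<close>.\<close>

lemma card_free_vars: "n - 1 - t \<le> card (free_vars n t a)"
proof -
  define W where "W = {1..n} - free_vars n t a"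
  have W: "W \<subseteq> {1..n}" "finite W" by (auto simp: W_def)
  have W_iff: "partial_deficit t a (i - 1) \<le> t" "Poly_Mapping.lookup a i < t" if "i \<in> W" for i
    using that by (auto simp: W_def free_vars_def)
  have "card W \<le> t + 1"
  proof (cases "W = {}")
    case False
    define l where "l = Max W"
    have l: "l \<in> W" "\<And>i. i \<in> W \<Longrightarrow> i \<le> l" using False W by (auto simp: l_def)
    have "card (W - {l}) = (\<Sum>i\<in>W - {l}. 1)" by simp
    also have "\<dots> \<le> (\<Sum>i\<in>W - {l}. t - Poly_Mapping.lookup a i)"
      using W_iff(2) by (intro sum_mono) fastforce
    also have "\<dots> \<le> partial_deficit t a (l - 1)"
      unfolding partial_deficit_def
    proof (rule sum_mono2)
      show "W - {l} \<subseteq> {1..l - 1}"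
      proof
        fix i assume i: "i \<in> W - {l}"
        then have "i \<le> l" "i \<noteq> l" "1 \<le> i" using l W by auto
        then show "i \<in> {1..l - 1}" by simp
      qed
    qed simp_all
    also have "\<dots> \<le> t" by (rule W_iff(1)[OF l(1)])
    finally show ?thesis using l W by simp
  qed simp
  moreover have "card W = n - card (free_vars n t a)"
    unfolding W_def by (subst card_Diff_subset) (auto simp: free_vars_def)
  ultimately show ?thesis by linarith
qed

text \<open>A Stanley decomposition has finitely many summands; cutting at \<open>t\<close> leaves
  finitely many starting exponents.\<close>

lemma finite_cell_starts: "finite (range (cell_start n t))"
proof (rule finite_subset)
  let ?mk = "\<lambda>g. \<Sum>i\<in>{1..n}. Poly_Mapping.single i (g i :: nat)"
  show "range (cell_start n t) \<subseteq> ?mk ` ({1..n} \<rightarrow>\<^sub>E {0..t})"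
  proof
    fix a assume "a \<in> range (cell_start n t)"
    then obtain e where a: "a = cell_start n t e" by blast
    let ?g = "\<lambda>i\<in>{1..n}. if partial_deficit t e (i - 1) \<le> t then min (Poly_Mapping.lookup e i) t else 0"
    have "a = ?mk ?g" unfolding a cell_start_def by (rule sum.cong) simp_all
    moreover have "?g \<in> {1..n} \<rightarrow>\<^sub>E {0..t}" by auto
    ultimately show "a \<in> ?mk ` ({1..n} \<rightarrow>\<^sub>E {0..t})" by (rule image_eqI)
  qed
  show "finite (?mk ` ({1..n} \<rightarrow>\<^sub>E {0..t}))" by (intro finite_imageI finite_PiE) auto
qed

lemma sdepth_quot_deficit:
  fixes I :: "'k::field mpoly set"
  assumes n: "n \<ge> 2" and t: "t \<ge> 1"
    and I_def: "I = monomial_ideal {1..n} (deficit_set n t (\<lambda>_. t))"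
  shows "sdepth n (quot_module (mpoly_ring {1..n}) I) (quot_component n I) = n - 1 - t"
proof -
  let ?U = "deficit_set n t (\<lambda>_. t)" and ?M = "quot_module (mpoly_ring {1..n}) I"
  note U = upward_closed_deficit_set[of "{1..n}" n t "\<lambda>_. t"]
  let ?L = "{Min ((\<lambda>i. card (Z i)) ` {1..r}) | r m Z. stanley_decomposition n ?M (quot_component n I) r m Z}"
  obtain e where e: "Poly_Mapping.keys e \<subseteq> {1..n}"
    "\<And>T. T \<subseteq> {1..n} \<Longrightarrow> e + indicator_exp T \<in> ?U \<longleftrightarrow> n - 1 - t < card T"
    using deficit_set_witness[OF n t] by blast
  have upper: "Min ((\<lambda>i. card (Z i)) ` {1..r}) \<le> n - 1 - t"
    if dec: "stanley_decomposition n ?M (quot_component n I) r m Z" for r m Z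
  proof -
    \<comment> \<open>A choice of \<open>n - 1 - t\<close> indices: \<open>x^e\<close> times their
      product is outside the ideal and every further variable moves it inside, so some
      \<open>Z i\<close> is contained in \<open>Y\<close>.\<close>
    define Y where "Y = {1..n - 1 - t}"
    have Y: "Y \<subseteq> {1..n}" "finite Y" "card Y = n - 1 - t" by (auto simp: Y_def)
    have "\<exists>i\<in>{1..r}. Z i \<subseteq> {1..n} - ({1..n} - Y)"
    proof (rule stanley_decomposition_bound[OF U I_def dec])
      show "Poly_Mapping.keys (e + indicator_exp Y) \<subseteq> {1..n}"
        using e(1) Y by (simp add: keys_exp_add keys_indicator_exp)
      show "e + indicator_exp Y \<notin> ?U" using e(2)[OF Y(1)] Y(3) by simp
      fix k assume k: "k \<in> {1..n} - Y"
      have "insert k Y - {k} = Y" using k by blast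
      then have "Poly_Mapping.single k 1 + (e + indicator_exp Y) = e + indicator_exp (insert k Y)"
        using indicator_exp_remove[of "insert k Y" k] Y(2) by (simp add: add.left_commute)
      moreover have "insert k Y \<subseteq> {1..n}" "card (insert k Y) = Suc (card Y)" using k Y by auto
      ultimately show "k \<in> {1..n} \<and> Poly_Mapping.single k 1 + (e + indicator_exp Y) \<in> ?U"
        using k e(2)[of "insert k Y"] Y(3) by (metis DiffD1 lessI)
    qed
    then obtain i where i: "i \<in> {1..r}" "Z i \<subseteq> Y" by blast
    have "Min ((\<lambda>i. card (Z i)) ` {1..r}) \<le> card (Z i)" using i by (intro Min_le) auto
    also have "\<dots> \<le> card Y" using i Y by (intro card_mono)
    finally show ?thesis using Y by simp
  qed
  \<comment> \<open>The cells are indexed by their starts, so monomials with the same start share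
    one summand.\<close>
  define A where "A = cell_start n t ` {e. Poly_Mapping.keys e \<subseteq> {1..n} \<and> e \<notin> ?U}"
  have "finite A" unfolding A_def by (rule finite_subset[OF _ finite_cell_starts]) blast
  then obtain h where h: "bij_betw h {1..card A} A" using ex_bij_betw_nat_finite_1 by blast
  have hA: "h i \<in> A" if "i \<in> {1..card A}" for i using bij_betwE[OF h] that by blast
  have cell: "cell_start n t e' = a \<and> e' \<notin> ?U" if "a \<in> A" "e' \<in> exp_cell a (free_vars n t a)" for a e'
    using that cell_start_of_cell[of a n t _ e'] unfolding A_def deficit_set_iff by blast
  have dec: "stanley_decomposition n ?M (quot_component n I) (card A)
      (\<lambda>i. I +>\<^bsub>mpoly_ring {1..n}\<^esub> monom (h i)) (\<lambda>i. free_vars n t (h i))"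
  proof (rule stanley_decomposition_cells[OF U I_def])
    fix i assume i: "i \<in> {1..card A}"
    show "Poly_Mapping.keys (h i) \<subseteq> {1..n}"
      using hA[OF i] unfolding A_def by (elim imageE) (simp only: keys_cell_start)
    show "free_vars n t (h i) \<subseteq> {1..n}" by (auto simp: free_vars_def)
    show "exp_cell (h i) (free_vars n t (h i)) \<inter> ?U = {}" using cell[OF hA[OF i]] by blast
  next
    fix e assume e: "Poly_Mapping.keys e \<subseteq> {1..n}" "e \<notin> ?U"
    then have "cell_start n t e \<in> A" unfolding A_def by blast
    then obtain i where "i \<in> {1..card A}" "h i = cell_start n t e"
      using h unfolding bij_betw_def by (metis imageE)
    then show "\<exists>i\<in>{1..card A}. e \<in> exp_cell (h i) (free_vars n t (h i))"
      using mem_own_cell[OF e(1), of t] by metis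
  next
    fix i k assume ik: "i \<in> {1..card A}" "k \<in> {1..card A}" "i \<noteq> k"
    then have "h i \<noteq> h k" using h unfolding bij_betw_def inj_on_def by blast
    show "exp_cell (h i) (free_vars n t (h i)) \<inter> exp_cell (h k) (free_vars n t (h k)) = {}"
    proof (rule equals0I)
      fix x assume x: "x \<in> exp_cell (h i) (free_vars n t (h i)) \<inter> exp_cell (h k) (free_vars n t (h k))"
      have "cell_start n t x = h i" using cell[OF hA[OF ik(1)] IntD1[OF x]] ..
      moreover have "cell_start n t x = h k" using cell[OF hA[OF ik(2)] IntD2[OF x]] ..
      ultimately show False using \<open>h i \<noteq> h k\<close> by simp
    qed
  qed
  \<comment> \<open>The monomial \<open>1\<close> is outside the ideal; over an empty index range
    \<open>Min\<close> would be unspecified.\<close>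
  have "A \<noteq> {}"
    unfolding A_def using zero_notin_deficit_set[OF n t] by (auto intro!: exI[of _ 0])
  then have "{1..card A} \<noteq> {}" using \<open>finite A\<close> by (simp add: Suc_le_eq card_gt_0_iff)
  then have "n - 1 - t \<le> Min ((\<lambda>i. card (free_vars n t (h i))) ` {1..card A})"
    using card_free_vars by (subst Min_ge_iff) auto
  then have "Min ((\<lambda>i. card (free_vars n t (h i))) ` {1..card A}) = n - 1 - t"
    using upper[OF dec] by linarith
  note Min = this
  have "n - 1 - t \<in> ?L" by (intro CollectI exI conjI, rule Min[symmetric], rule dec)
  moreover have "l \<le> n - 1 - t" if "l \<in> ?L" for l using that upper by blast
  moreover from this have "finite ?L" by (meson finite_nat_set_iff_bounded_le)
  ultimately show ?thesis unfolding sdepth_def by (intro Max_eqI)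
qed

theorem theorem3p1:
  fixes n t :: nat
    and S :: "'k::field mpoly ring"
    and J I :: "'k mpoly set"
    and M :: "('k mpoly, 'k mpoly set) module"
  assumes "n \<ge> 3" and "t \<ge> 1"
    and "S = mpoly_ring {1..n}"
    and "J = cycle_path_ideal n (n - 1)"
    and "I = J [^]\<^bsub>ideals_set S\<^esub> t"
    and "M = quot_module S I"
  shows "sdepth n M (quot_component n I) = depth S (graded_max_ideal n) M \<and>
         depth S (graded_max_ideal n) M = (if t \<le> n - 2 then n - t - 1 else 0)"
proof -
  have n: "n \<ge> 2" "n \<ge> 1" using assms(1) by simp_all
  have I: "I = monomial_ideal {1..n} (deficit_set n t (\<lambda>_. t))"
    unfolding assms(3-5) by (rule cycle_path_ideal_power[OF n(2)])
  have "depth S (graded_max_ideal n) M = n - 1 - t"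
    unfolding assms(3,6) by (rule depth_quot_deficit[OF n(1) assms(2) I])
  moreover have "sdepth n M (quot_component n I) = n - 1 - t"
    unfolding assms(3,6) by (rule sdepth_quot_deficit[OF n(1) assms(2) I])
  \<comment> \<open>Truncated subtraction yields both cases: \<open>n - 1 - t\<close> is
    \<open>0\<close> once \<open>t >= n - 1\<close>.\<close>
  ultimately show ?thesis by auto
qed

end
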